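(* Let $K:[0,1]^2\to\mathbb{R}$, $(t,s)\mapsto K(t,s)$, be continuous and continuously differentiable with respect to $t$, with $K(0,0)\neq 0$. Let $W(t)$, $t\in[0,1]$, be a one-dimensional Wiener process and let $X(t)$, $t\in[0,1]$, be a continuous modification of the Volterra Gaussian process $\int_0^t K(t,s)\,\mathrm{d}W(s)$, $t\in[0,1]$. Then, almost surely, $$\limsup_{t\to 0+}\frac{X(t)}{\sqrt{2\,\mathsf{E}\left(X(t)^2\right)\log\log\frac{1}{t}}}=1.$$
   Context: "Continuously differentiable with respect to $t$" means that the partial derivative $\partial K/\partial t$ exists and is continuous on $[0,1]^2$ (one-sided at the endpoints). Under these assumptions the process $\int_0^tK(t,s)\,\mathrm{d}W(s)$ has a continuous modification. *)

theory Defs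
  imports "HOL-Probability.Probability"
begin

definition wiener_process :: "'a measure \<Rightarrow> (real \<Rightarrow> 'a \<Rightarrow> real) \<Rightarrow> bool" where
  "wiener_process M W \<longleftrightarrow>
     prob_space M \<and>
     (\<forall>t\<in>{0..1}. W t \<in> borel_measurable M) \<and>
     (AE \<omega> in M. W 0 \<omega> = 0) \<and>
     (\<forall>(p :: nat \<Rightarrow> real) n. mono_on {..n} p \<and> p ` {..n} \<subseteq> {0..1} \<longrightarrow>
        prob_space.indep_vars M (\<lambda>_. borel) (\<lambda>i \<omega>. W (p (Suc i)) \<omega> - W (p i) \<omega>) {..<n}) \<and>
     (\<forall>s t. 0 \<le> s \<and> s < t \<and> t \<le> 1 \<longrightarrow>
        distributed M lborel (\<lambda>\<omega>. W t \<omega> - W s \<omega>) (normal_density 0 (sqrt (t - s)))) \<and>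
     (AE \<omega> in M. continuous_on {0..1} (\<lambda>t. W t \<omega>))"

definition step_fun :: "nat \<Rightarrow> (nat \<Rightarrow> real) \<Rightarrow> (nat \<Rightarrow> real) \<Rightarrow> real \<Rightarrow> real" where
  "step_fun n p c s = (\<Sum>i<n. c i * indicator {p i<..p (Suc i)} s)"

definition wiener_sum ::
  "(real \<Rightarrow> 'a \<Rightarrow> real) \<Rightarrow> nat \<Rightarrow> (nat \<Rightarrow> real) \<Rightarrow> (nat \<Rightarrow> real) \<Rightarrow> 'a \<Rightarrow> real" where
  "wiener_sum W n p c \<omega> = (\<Sum>i<n. c i * (W (p (Suc i)) \<omega> - W (p i) \<omega>))"

text \<open>The random variable \<open>Y\<close> is a version of the Wiener integral of the deterministic function
  \<open>f\<close> over \<open>[0, t]\<close>, that is, the \<open>L\<^sup>2(M)\<close>-limit of the integrals of step functions that converge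
  to \<open>f\<close> in \<open>L\<^sup>2[0, t]\<close>.  It determines \<open>Y\<close> up to almost sure equality, and by the isometry
  property it does not depend on the approximating sequence.  Nonnegative integrals are used so
  that convergence to zero entails finiteness of the \<open>L\<^sup>2\<close> distances.\<close>

definition has_wiener_integral ::
  "'a measure \<Rightarrow> (real \<Rightarrow> 'a \<Rightarrow> real) \<Rightarrow> real \<Rightarrow> (real \<Rightarrow> real) \<Rightarrow> ('a \<Rightarrow> real) \<Rightarrow> bool" where
  "has_wiener_integral M W t f Y \<longleftrightarrow>
     set_borel_measurable lborel {0..t} f \<and> Y \<in> borel_measurable M \<and>
     (\<exists>(n :: nat \<Rightarrow> nat) (p :: nat \<Rightarrow> nat \<Rightarrow> real) (c :: nat \<Rightarrow> nat \<Rightarrow> real).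
        (\<forall>k. p k 0 = 0 \<and> p k (n k) = t \<and> mono_on {..n k} (p k)) \<and>
        (\<lambda>k. \<integral>\<^sup>+ s\<in>{0..t}. ennreal ((f s - step_fun (n k) (p k) (c k) s)\<^sup>2) \<partial>lborel)
          \<longlonglongrightarrow> 0 \<and>
        (\<lambda>k. \<integral>\<^sup>+ \<omega>. ennreal ((Y \<omega> - wiener_sum W (n k) (p k) (c k) \<omega>)\<^sup>2) \<partial>M)
          \<longlonglongrightarrow> 0)"

text \<open>The Wiener integrals are defined only up to almost sure equality, separately for each \<open>t\<close>;
  \<open>Y\<close> is an arbitrary choice of versions.\<close>

definition volterra_process ::
  "'a measure \<Rightarrow> (real \<Rightarrow> 'a \<Rightarrow> real) \<Rightarrow> (real \<Rightarrow> real \<Rightarrow> real) \<Rightarrow> (real \<Rightarrow> 'a \<Rightarrow> real) \<Rightarrow> bool" where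
  "volterra_process M W K Y \<longleftrightarrow> (\<forall>t\<in>{0..1}. has_wiener_integral M W t (K t) (Y t))"

definition continuous_modification ::
  "'a measure \<Rightarrow> real set \<Rightarrow> (real \<Rightarrow> 'a \<Rightarrow> real) \<Rightarrow> (real \<Rightarrow> 'a \<Rightarrow> real) \<Rightarrow> bool" where
  "continuous_modification M T Y X \<longleftrightarrow>
     (\<forall>t\<in>T. X t \<in> borel_measurable M \<and> (AE \<omega> in M. X t \<omega> = Y t \<omega>)) \<and>
     (AE \<omega> in M. continuous_on T (\<lambda>t. X t \<omega>))"

text \<open>Derivatives within \<open>{0..1}\<close> are one-sided at the endpoints.\<close>

definition continuously_differentiable_fst :: "(real \<Rightarrow> real \<Rightarrow> real) \<Rightarrow> bool" where
  "continuously_differentiable_fst K \<longleftrightarrow>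
     (\<exists>K'. (\<forall>t\<in>{0..1}. \<forall>s\<in>{0..1}.
              ((\<lambda>u. K u s) has_real_derivative K' t s) (at t within {0..1})) \<and>
           continuous_on ({0..1} \<times> {0..1}) (\<lambda>(t, s). K' t s))"

end

theory Submission
  imports Defs "HOL-Real_Asymp.Real_Asymp"
begin

text \<open>
  Freeze the kernel at the origin: \<open>X(t) = K(0,0) W(t) + R(t)\<close>, where \<open>R(t)\<close> is the Wiener integral of
  \<open>K(t,s) - K(0,0)\<close>.  By continuity of \<open>K\<close> at the origin and boundedness of \<open>\<partial>K/\<partial>t\<close>, the increments of
  \<open>R\<close> on \<open>[0,\<delta>]\<close> are sub-Gaussian with variance at most \<open>\<epsilon> (t - u)\<close>, and \<open>\<epsilon>\<close> tends to \<open>0\<close> with \<open>\<delta>\<close>.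
  Dyadic chaining then makes \<open>R\<close> negligible against \<open>sqrt (2 t log log (1/t))\<close>; crude constants suffice
  because \<open>\<epsilon>\<close> is arbitrary.  What remains is the law of the iterated logarithm for \<open>W\<close> itself.  Its upper
  half uses sharp Gaussian tails along a geometric grid of ratio close to \<open>1\<close>, and the same chaining bound
  in place of a maximal inequality to fill the gaps; its lower half uses the independent increments along
  a sparse geometric grid.
\<close>

section \<open>Gaussian tails and the second Borel-Cantelli lemma\<close>

text \<open>In general the remainder \<open>R\<close> is neither a martingale nor a process with
  independent increments; what is at hand is a Gaussian-type tail for each single increment, and
  chaining needs nothing more. Chaining loses a constant factor, so it is applied only where a small
  factor compensates: the small variance rate \<epsilon> for \<open>R\<close>, the small relative
  width of a grid cell for \<open>W\<close>. The sharp constant 1 comes from one-dimensional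
  Gaussian tails at grid points alone. Each Wiener integral is fixed only up to a null set depending
  on \<open>t\<close>. Chaining looks at countably many dyadic points, and path continuity supplies
  the others. The tails of \<open>R\<close> are obtained for sums over step functions and carried
  through the \<open>L^2\<close> limit at the price of worse constants. The theorem normalises by
  the true second moment of \<open>X(t)\<close>, not by \<open>K(0,0)^2 t\<close>; a separate
  estimate shows that their ratio tends to 1. The sign of \<open>K(0,0)\<close> is absorbed by the
  symmetry of \<open>W\<close>.\<close>

lemma (in prob_space) normal_tail_le:
  assumes D: "distributed M lborel X (normal_density 0 \<sigma>)" and "0 < \<sigma>" "0 \<le> x"
  shows "prob {\<omega> \<in> space M. x \<le> X \<omega>} \<le> exp (- x\<^sup>2 / (2 * \<sigma>\<^sup>2))"
proof -
  \<comment> \<open>On \<open>[x, \<infinity>)\<close> the density is dominated by the same density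
    recentred at \<open>x\<close>, times the claimed bound; the recentred one has total mass
    1.\<close>
  have pointwise: "normal_density 0 \<sigma> y \<le> exp (- x\<^sup>2 / (2 * \<sigma>\<^sup>2)) * normal_density x \<sigma> y"
    if "x \<le> y" for y
  proof -
    have "(y - x)\<^sup>2 + x\<^sup>2 \<le> y\<^sup>2"
      using mult_left_mono[OF that \<open>0 \<le> x\<close>] by (simp add: power2_eq_square algebra_simps)
    then have "- (y\<^sup>2 / (2 * \<sigma>\<^sup>2)) \<le> - x\<^sup>2 / (2 * \<sigma>\<^sup>2) + - ((y - x)\<^sup>2 / (2 * \<sigma>\<^sup>2))"
      using \<open>0 < \<sigma>\<close> by (simp add: field_simps)
    then have "exp (- (y\<^sup>2 / (2 * \<sigma>\<^sup>2))) \<le> exp (- x\<^sup>2 / (2 * \<sigma>\<^sup>2)) * exp (- ((y - x)\<^sup>2 / (2 * \<sigma>\<^sup>2)))"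
      by (simp flip: exp_add)
    from mult_left_mono[OF this, of "1 / sqrt (2 * pi * \<sigma>\<^sup>2)"] show ?thesis
      by (simp add: normal_density_def mult_ac)
  qed
  have "emeasure M {\<omega> \<in> space M. x \<le> X \<omega>} = emeasure M (X -` {x..} \<inter> space M)"
    by (intro arg_cong2[where f=emeasure]) auto
  also have "\<dots> = (\<integral>\<^sup>+y. ennreal (normal_density 0 \<sigma> y) * indicator {x..} y \<partial>lborel)"
    by (rule distributed_emeasure[OF D]) simp
  also have "\<dots> \<le> (\<integral>\<^sup>+y. ennreal (exp (- x\<^sup>2 / (2 * \<sigma>\<^sup>2))) * ennreal (normal_density x \<sigma> y) \<partial>lborel)"
    using pointwise
    by (intro nn_integral_mono) (auto simp: indicator_def ennreal_mult[symmetric] intro!: ennreal_leI)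
  also have "\<dots> = ennreal (exp (- x\<^sup>2 / (2 * \<sigma>\<^sup>2)))"
    using prob_space.emeasure_space_1[OF prob_space_normal_density[OF \<open>0 < \<sigma>\<close>, of x]]
    by (simp add: nn_integral_cmult emeasure_density)
  finally show ?thesis
    by (simp add: emeasure_eq_measure)
qed

lemma (in prob_space) normal_abs_tail_le:
  assumes D: "distributed M lborel X (normal_density 0 \<sigma>)" and "0 < \<sigma>" "0 \<le> x"
  shows "prob {\<omega> \<in> space M. x \<le> \<bar>X \<omega>\<bar>} \<le> 2 * exp (- x\<^sup>2 / (2 * \<sigma>\<^sup>2))"
proof -
  have [measurable]: "X \<in> borel_measurable M"
    using distributed_measurable[OF D] by simp
  have D': "distributed M lborel (\<lambda>\<omega>. - X \<omega>) (normal_density 0 \<sigma>)"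
    using normal_density_affine[OF D \<open>0 < \<sigma>\<close>, of "-1" 0] by simp
  have "prob {\<omega> \<in> space M. x \<le> \<bar>X \<omega>\<bar>}
      \<le> prob ({\<omega> \<in> space M. x \<le> X \<omega>} \<union> {\<omega> \<in> space M. x \<le> - X \<omega>})"
    by (intro finite_measure_mono) auto
  also have "\<dots> \<le> prob {\<omega> \<in> space M. x \<le> X \<omega>} + prob {\<omega> \<in> space M. x \<le> - X \<omega>}"
    by (intro measure_Un_le) auto
  finally show ?thesis
    using normal_tail_le[OF D assms(2,3)] normal_tail_le[OF D' assms(2,3)] by simp
qed

text \<open>The tail is bounded below by one interval of length \<sigma> starting at \<sigma> x, on
  which the density is least at the right end. The resulting shift from \<open>x\<close> to
  \<open>x + 1\<close> is compensated later by subtracting 1 from the threshold.\<close>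

lemma (in prob_space) normal_tail_ge:
  assumes D: "distributed M lborel X (normal_density 0 \<sigma>)" and "0 < \<sigma>" "0 \<le> x"
  shows "exp (- (x + 1)\<^sup>2 / 2) / sqrt (2 * pi) \<le> prob {\<omega> \<in> space M. \<sigma> * x \<le> X \<omega>}"
proof -
  have pointwise: "exp (- (x + 1)\<^sup>2 / 2) / (sqrt (2 * pi) * \<sigma>) \<le> normal_density 0 \<sigma> y"
    if "y \<in> {\<sigma> * x..\<sigma> * (x + 1)}" for y
  proof -
    have "0 \<le> \<sigma> * x" using \<open>0 < \<sigma>\<close> \<open>0 \<le> x\<close> by simp
    then have "0 \<le> y" using that by (meson atLeastAtMost_iff order_trans)
    then have "\<bar>y\<bar> \<le> \<sigma> * (x + 1)" using that by simp
    then have "y\<^sup>2 \<le> (\<sigma> * (x + 1))\<^sup>2"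
      by (rule abs_le_square_iff[THEN iffD1, OF order_trans]) simp
    then have "- (x + 1)\<^sup>2 / 2 \<le> - (y\<^sup>2 / (2 * \<sigma>\<^sup>2))"
      using \<open>0 < \<sigma>\<close> by (simp add: power_mult_distrib divide_simps) (simp add: mult_ac)
    then show ?thesis
      using \<open>0 < \<sigma>\<close> by (simp add: normal_density_def real_sqrt_mult field_simps)
  qed
  have "ennreal (exp (- (x + 1)\<^sup>2 / 2) / sqrt (2 * pi))
      = ennreal (exp (- (x + 1)\<^sup>2 / 2) / (sqrt (2 * pi) * \<sigma>)) * ennreal \<sigma>"
    using \<open>0 < \<sigma>\<close> by (simp flip: ennreal_mult)
  also have "\<dots> = (\<integral>\<^sup>+y. ennreal (exp (- (x + 1)\<^sup>2 / 2) / (sqrt (2 * pi) * \<sigma>))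
      * indicator {\<sigma> * x..\<sigma> * (x + 1)} y \<partial>lborel)"
    using \<open>0 < \<sigma>\<close> by (subst nn_integral_cmult_indicator) (auto simp: algebra_simps)
  also have "\<dots> \<le> (\<integral>\<^sup>+y. ennreal (normal_density 0 \<sigma> y) * indicator {\<sigma> * x..} y \<partial>lborel)"
    using pointwise by (intro nn_integral_mono) (auto simp: indicator_def intro!: ennreal_leI)
  also have "\<dots> = emeasure M (X -` {\<sigma> * x..} \<inter> space M)"
    by (rule distributed_emeasure[OF D, symmetric]) simp
  also have "\<dots> = emeasure M {\<omega> \<in> space M. \<sigma> * x \<le> X \<omega>}"
    by (intro arg_cong2[where f=emeasure]) auto
  finally show ?thesis
    by (simp add: emeasure_eq_measure)
qed

text \<open>Second Borel-Cantelli lemma. Independence turns the probability of no hit in a block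
  into a product of factors \<open>1 - p n \<le> exp (- p n)\<close>, and divergence of the series
  sends the product to zero.\<close>

lemma (in prob_space) borel_cantelli_indep_vars:
  assumes indep: "indep_vars N X UNIV"
    and S: "\<And>n. S n \<in> sets (N n)"
    and div: "\<not> summable (\<lambda>n::nat. prob (X n -` S n \<inter> space M))"
  shows "AE \<omega> in M. \<exists>\<^sub>F n in sequentially. X n \<omega> \<in> S n"
proof -
  have X[measurable]: "X n \<in> measurable M (N n)" for n
    using indep by (auto simp: indep_vars_def)
  note S[measurable]
  define p where "p n = prob (X n -` S n \<inter> space M)" for n
  define B where "B a = {\<omega> \<in> space M. \<forall>n\<ge>a. X n \<omega> \<notin> S n}" for a
  have B[measurable]: "B a \<in> events" for a
    unfolding B_def by measurable
  \<comment> \<open>The strict inequality keeps the block nonempty, as the product formula for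
    independent variables requires.\<close>
  have B_le: "prob (B a) \<le> exp (- (\<Sum>n\<in>{a..<b}. p n))" if "a < b" for a b
  proof -
    let ?C = "\<lambda>n. space (N n) - S n"
    have compl: "prob (X n -` ?C n \<inter> space M) = 1 - p n" for n
    proof -
      have "X n -` ?C n \<inter> space M = space M - (X n -` S n \<inter> space M)"
        using measurable_space[OF X[of n]] by auto
      then show ?thesis
        unfolding p_def by (simp add: prob_compl)
    qed
    have "prob (B a) \<le> prob (\<Inter>n\<in>{a..<b}. X n -` ?C n \<inter> space M)"
      using that measurable_space[OF X] by (intro finite_measure_mono) (auto simp: B_def)
    also have "\<dots> = (\<Prod>n\<in>{a..<b}. 1 - p n)"
      using that by (subst indep_varsD[OF indep]) (auto simp: compl)
    also have "\<dots> \<le> (\<Prod>n\<in>{a..<b}. exp (- p n))"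
      by (intro prod_mono) (use exp_ge_add_one_self[of "- p _"] in \<open>auto simp: p_def\<close>)
    also have "\<dots> = exp (- (\<Sum>n\<in>{a..<b}. p n))"
      by (simp add: exp_sum flip: sum_negf)
    finally show ?thesis .
  qed
  have "prob (B a) = 0" for a
  proof -
    have unbounded: "\<exists>b>a. y \<le> (\<Sum>n\<in>{a..<b}. p n)" for y
    proof (rule ccontr)
      assume "\<not> ?thesis"
      then have *: "(\<Sum>n\<in>{a..<b}. p n) \<le> y" if "b > a" for b
        using that by force
      have "summable (\<lambda>n. p (n + a))"
      proof (rule summableI_nonneg_bounded)
        fix n
        have "(\<Sum>i<n. p (i + a)) \<le> (\<Sum>i<Suc n. p (i + a))"
          by (simp add: p_def)
        also have "\<dots> = (\<Sum>n\<in>{a..<Suc n + a}. p n)"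
          using sum.shift_bounds_nat_ivl[of p 0 a "Suc n"] by (simp only: lessThan_atLeast0 add_0)
        finally show "(\<Sum>i<n. p (i + a)) \<le> y"
          using *[of "Suc n + a"] by simp
      qed (simp add: p_def)
      then show False
        using div by (simp add: p_def[symmetric] summable_iff_shift)
    qed
    have "prob (B a) \<le> exp (- y)" for y
      using unbounded[of y] B_le[of a] by (meson exp_le_cancel_iff neg_le_iff_le order_trans)
    moreover have "((\<lambda>y. exp (- y)) \<longlongrightarrow> 0) (at_top :: real filter)"
      by (intro filterlim_compose[OF exp_at_bot] filterlim_uminus_at_bot_at_top)
    ultimately have "prob (B a) \<le> 0"
      by (intro tendsto_lowerbound[where F="at_top::real filter"]) auto
    then show ?thesis
      by (simp add: measure_le_0_iff)
  qed
  then have "AE \<omega> in M. \<forall>a. \<omega> \<notin> B a"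
    by (intro AE_all_countable[THEN iffD2] allI AE_not_in) (simp add: null_sets_def emeasure_eq_measure)
  then show ?thesis
    by (rule AE_mp) (rule AE_I2, auto simp: B_def frequently_sequentially)
qed

section \<open>Chaining\<close>

text \<open>A dyadic point of level \<open>m\<close> is reached from \<open>u\<close> by at most one
  increment of each level up to \<open>m\<close>, so the total is below the geometric series with
  ratio 3/4, whose sum is 4. Continuity extends the bound from dyadic points to all of the
  interval.\<close>

lemma dyadic_increments_le:
  fixes f :: "real \<Rightarrow> real"
  assumes "0 < d" and cont: "continuous_on {u..u + d} f"
    and incr: "\<And>m j. j < 2 ^ m \<Longrightarrow>
      \<bar>f (u + real (Suc j) * d / 2 ^ m) - f (u + real j * d / 2 ^ m)\<bar> \<le> c * (3 / 4) ^ m"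
    and t: "t \<in> {u..u + d}"
  shows "\<bar>f t - f u\<bar> \<le> 4 * c"
proof -
  have "0 \<le> c"
    using incr[of 0 0] by (simp add: order_trans[OF abs_ge_zero])
  have dyadic: "\<bar>f (u + real j * d / 2 ^ m) - f u\<bar> \<le> c * (\<Sum>l\<le>m. (3 / 4) ^ l)" if "j \<le> 2 ^ m" for m j
    using that
  proof (induction m arbitrary: j)
    case 0
    then have "j = 0 \<or> j = 1" by auto
    then show ?case using incr[of 0 0] \<open>0 \<le> c\<close> by auto
  next
    case (Suc m)
    \<comment> \<open>The parent on the coarser level: an even \<open>j\<close> is the same point as
      \<open>i\<close> there, an odd \<open>j\<close> lies one fine increment to its right.\<close>
    define i where "i = j div 2"
    have i: "i \<le> 2 ^ m" using Suc.prems by (auto simp: i_def)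
    have half: "real (2 * i) * d / 2 ^ Suc m = real i * d / 2 ^ m" by simp
    show ?case
    proof (cases "even j")
      case True
      then have "j = 2 * i" by (simp add: i_def)
      then have "\<bar>f (u + real j * d / 2 ^ Suc m) - f u\<bar> \<le> c * (\<Sum>l\<le>m. (3 / 4) ^ l)"
        using Suc.IH[OF i] half by metis
      also have "\<dots> \<le> c * (\<Sum>l\<le>Suc m. (3 / 4) ^ l)"
        using \<open>0 \<le> c\<close> by (intro mult_left_mono) auto
      finally show ?thesis .
    next
      case False
      then have j: "j = Suc (2 * i)" by (simp add: i_def)
      then have "2 * i < 2 ^ Suc m" using Suc.prems by simp
      from incr[OF this] Suc.IH[OF i]
      have "\<bar>f (u + real j * d / 2 ^ Suc m) - f u\<bar>
          \<le> c * (3 / 4) ^ Suc m + c * (\<Sum>l\<le>m. (3 / 4) ^ l)"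
        unfolding j half by linarith
      then show ?thesis by (simp add: algebra_simps)
    qed
  qed
  have "(\<Sum>l\<le>m. (3 / 4 :: real) ^ l) = 4 - 3 * (3 / 4) ^ m" for m
    by (induction m) auto
  then have geometric: "(\<Sum>l\<le>m. (3 / 4 :: real) ^ l) \<le> 4" for m
    by simp
  \<comment> \<open>The nearest dyadic point of level \<open>m\<close> to the left of
    \<open>t\<close>; it stays inside the interval and converges to \<open>t\<close>.\<close>
  define j where "j m = nat \<lfloor>(t - u) / d * 2 ^ m\<rfloor>" for m
  have frac: "0 \<le> (t - u) / d" "(t - u) / d \<le> 1"
    using t \<open>0 < d\<close> by auto
  have j: "real (j m) = of_int \<lfloor>(t - u) / d * 2 ^ m\<rfloor>" for m
  proof -
    have "0 \<le> (t - u) / d * 2 ^ m" using frac(1) by (intro mult_nonneg_nonneg) auto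
    then show ?thesis by (simp add: j_def del: times_divide_eq_left)
  qed
  have j_le: "real (j m) \<le> (t - u) / d * 2 ^ m" "(t - u) / d * 2 ^ m \<le> real (j m) + 1" for m
    unfolding j by linarith+
  have j_pow: "j m \<le> 2 ^ m" for m
  proof -
    have "real (j m) \<le> 1 * 2 ^ m"
      using j_le(1)[of m] frac by (meson mult_right_mono order_trans zero_le_numeral zero_le_power)
    then show ?thesis by (metis mult_1 of_nat_le_iff of_nat_numeral of_nat_power)
  qed
  have upper: "u + real (j m) * d / 2 ^ m \<le> t" for m
    using j_le(1)[of m] \<open>0 < d\<close> by (simp add: field_simps)
  have lower: "t - d / 2 ^ m \<le> u + real (j m) * d / 2 ^ m" for m
  proof -
    have "(t - u) * 2 ^ m \<le> (real (j m) + 1) * d"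
      using j_le(2)[of m] \<open>0 < d\<close> by (simp add: field_simps)
    then have "t - u \<le> (real (j m) + 1) * d / 2 ^ m"
      by (simp add: pos_le_divide_eq)
    then show ?thesis by (simp add: add_divide_distrib distrib_right)
  qed
  have "(\<lambda>m. t - d / 2 ^ m) \<longlonglongrightarrow> t"
    by real_asymp
  from tendsto_sandwich[OF _ _ this tendsto_const] upper lower
  have lim: "(\<lambda>m. u + real (j m) * d / 2 ^ m) \<longlonglongrightarrow> t"
    by auto
  have "u + real (j m) * d / 2 ^ m \<in> {u..u + d}" for m
    using upper[of m] t \<open>0 < d\<close> by auto
  then have "(\<lambda>m. f (u + real (j m) * d / 2 ^ m)) \<longlonglongrightarrow> f t"
    by (intro continuous_on_tendsto_compose[OF cont lim t]) auto
  then have "(\<lambda>m. \<bar>f (u + real (j m) * d / 2 ^ m) - f u\<bar>) \<longlonglongrightarrow> \<bar>f t - f u\<bar>"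
    by (intro tendsto_intros)
  moreover have "\<bar>f (u + real (j m) * d / 2 ^ m) - f u\<bar> \<le> 4 * c" for m
    using dyadic[OF j_pow[of m]] mult_left_mono[OF geometric[of m] \<open>0 \<le> c\<close>] by simp
  ultimately show ?thesis
    by (intro LIMSEQ_le_const2) auto
qed

text \<open>Stands in for a maximal inequality, from tails of single increments alone. The factor 12
  is the geometric sum 4 times the 3 in the threshold \<open>c\<close>. The parameter
  \<open>y\<close> trades the size of the bound against the probability of failure, and
  \<open>y^2 = 2 ln n\<close> will make the latter summable.\<close>

lemma (in prob_space) chaining:
  fixes Z :: "real \<Rightarrow> 'a \<Rightarrow> real"
  assumes "0 < d" "0 < b" and y: "0 < y" "4 * exp (- y\<^sup>2) \<le> 1"
    and Z: "\<And>t. t \<in> {u..u + d} \<Longrightarrow> Z t \<in> borel_measurable M"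
    and tail: "\<And>s t x. u \<le> s \<Longrightarrow> s < t \<Longrightarrow> t \<le> u + d \<Longrightarrow> 0 < x \<Longrightarrow>
      prob {\<omega> \<in> space M. x \<le> \<bar>Z t \<omega> - Z s \<omega>\<bar>} \<le> 2 * exp (- x\<^sup>2 / (b * (t - s)))"
  obtains A where "A \<in> events" "prob A \<le> 4 * exp (- y\<^sup>2)"
    and "\<And>\<omega> t. \<omega> \<in> space M - A \<Longrightarrow> continuous_on {u..u + d} (\<lambda>t. Z t \<omega>) \<Longrightarrow> t \<in> {u..u + d} \<Longrightarrow>
      \<bar>Z t \<omega> - Z u \<omega>\<bar> \<le> 12 * y * sqrt (b * d)"
proof -
  \<comment> \<open>The square of \<open>3 (3/4)^m\<close>, divided by the relative gap
    \<open>2^(-m)\<close>, is \<open>9 (9/8)^m\<close>. By Bernoulli's inequality this is at least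
    \<open>m + 1\<close>, so each level gains another factor \<open>exp (- y^2)\<close>.\<close>
  define c where "c = 3 * y * sqrt (b * d)"
  have "0 < c" using assms by (simp add: c_def)
  define \<tau> where "\<tau> m j = u + real j * d / 2 ^ m" for m j :: nat
  (* The thresholds c (3/4)^m are summable, yet exceed the standard deviations of order 2^(-m/2) by a
     factor growing fast enough to pay for the union bound over 2^m increments. *)
  define D where "D m j = {\<omega> \<in> space M. c * (3 / 4) ^ m \<le> \<bar>Z (\<tau> m (Suc j)) \<omega> - Z (\<tau> m j) \<omega>\<bar>}"
    for m j
  define E where "E m = (\<Union>j<2 ^ m. D m j)" for m
  have \<tau>: "\<tau> m j \<in> {u..u + d}" if "j \<le> 2 ^ m" for m j
  proof -
    have "real j \<le> 2 ^ m" using that by (metis of_nat_le_iff of_nat_numeral of_nat_power)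
    then have "real j * d \<le> 2 ^ m * d" using \<open>0 < d\<close> by simp
    then show ?thesis using \<open>0 < d\<close> by (simp add: \<tau>_def field_simps)
  qed
  have D[measurable]: "D m j \<in> events" if "j < 2 ^ m" for m j
    using that unfolding D_def by (measurable; intro Z \<tau>; simp)
  have E[measurable]: "E m \<in> events" for m
    using D unfolding E_def by auto
  \<comment> \<open>With \<open>2^m\<close> increments, each exceeding its threshold with
    probability at most \<open>2 exp (- y^2)^(m+1)\<close>, level \<open>m\<close> fails with
    probability at most \<open>q^(m+1)\<close>. The assumption on \<open>y\<close> says
    \<open>q \<le> 1/2\<close>, whence the sum over levels is at most \<open>2 q\<close>.\<close>
  define q where "q = 2 * exp (- y\<^sup>2)"
  have q: "0 < q" "2 * q \<le> 1" using y by (auto simp: q_def)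
  have E_le: "prob (E m) \<le> q ^ Suc m" for m
  proof -
    have D_le: "prob (D m j) \<le> 2 * exp (- y\<^sup>2) ^ Suc m" if "j < 2 ^ m" for j
    proof -
      have gap: "\<tau> m (Suc j) - \<tau> m j = d / 2 ^ m" by (simp add: \<tau>_def field_simps)
      have "prob (D m j) \<le> 2 * exp (- (c * (3 / 4) ^ m)\<^sup>2 / (b * (\<tau> m (Suc j) - \<tau> m j)))"
        unfolding D_def using that gap \<tau>[of j m] \<tau>[of "Suc j" m] \<open>0 < d\<close> \<open>0 < c\<close>
        by (intro tail) (auto simp: algebra_simps)
      also have "- (c * (3 / 4) ^ m)\<^sup>2 / (b * (\<tau> m (Suc j) - \<tau> m j))
          = - (y\<^sup>2 * (9 * ((3 / 4) ^ m)\<^sup>2 * 2 ^ m))"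
        using assms(1,2) by (simp add: gap c_def power_mult_distrib)
      also have "9 * ((3 / 4) ^ m)\<^sup>2 * 2 ^ m = 9 * (9 / 8 :: real) ^ m"
        by (simp add: power2_eq_square flip: power_mult_distrib)
      finally have *: "prob (D m j) \<le> 2 * exp (- (y\<^sup>2 * (9 * (9 / 8) ^ m)))" .
      have "1 + real m * (1 / 8) \<le> (1 + 1 / 8) ^ m"
        using Bernoulli_inequality[of "1 / 8" m] by simp
      then have "real (Suc m) \<le> 9 * (9 / 8) ^ m" by simp
      then have "y\<^sup>2 * real (Suc m) \<le> y\<^sup>2 * (9 * (9 / 8) ^ m)"
        by (rule mult_left_mono) simp
      then have "- (y\<^sup>2 * (9 * (9 / 8) ^ m)) \<le> real (Suc m) * - y\<^sup>2"
        by (simp add: mult.commute)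
      then have "exp (- (y\<^sup>2 * (9 * (9 / 8) ^ m))) \<le> exp (real (Suc m) * - y\<^sup>2)"
        by (rule exp_le_cancel_iff[THEN iffD2])
      also have "\<dots> = exp (- y\<^sup>2) ^ Suc m"
        by (rule exp_of_nat_mult)
      finally show ?thesis using * by linarith
    qed
    have "prob (E m) \<le> (\<Sum>j<2 ^ m. prob (D m j))"
      unfolding E_def using D by (intro finite_measure_subadditive_finite) auto
    also have "\<dots> \<le> (\<Sum>j<(2::nat) ^ m. 2 * exp (- y\<^sup>2) ^ Suc m)"
      using D_le by (intro sum_mono) auto
    also have "\<dots> = q ^ Suc m"
      by (simp add: q_def power_mult_distrib mult_ac)
    finally show ?thesis .
  qed
  have sum: "(\<lambda>m. q ^ Suc m) sums (q * (1 / (1 - q)))"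
    using q sums_mult[OF geometric_sums[of q], of q] by simp
  have summable: "summable (\<lambda>m. prob (E m))"
    using E_le by (intro summable_comparison_test'[OF sums_summable[OF sum], of 0]) auto
  show thesis
  proof (rule that[of "\<Union>m. E m"])
    show "(\<Union>m. E m) \<in> events" by auto
    have "prob (\<Union>m. E m) \<le> (\<Sum>m. prob (E m))"
      using summable by (intro finite_measure_subadditive_countably) auto
    also have "\<dots> \<le> (\<Sum>m. q ^ Suc m)"
      by (intro suminf_le E_le summable sums_summable[OF sum])
    also have "\<dots> = q / (1 - q)" using sums_unique[OF sum] by simp
    also have "\<dots> \<le> 2 * q" using q by (simp add: field_simps)
    finally show "prob (\<Union>m. E m) \<le> 4 * exp (- y\<^sup>2)" by (simp add: q_def)
  next
    fix \<omega> t
    assume \<omega>: "\<omega> \<in> space M - (\<Union>m. E m)" and cont: "continuous_on {u..u + d} (\<lambda>t. Z t \<omega>)"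
      and t: "t \<in> {u..u + d}"
    have "\<bar>Z t \<omega> - Z u \<omega>\<bar> \<le> 4 * c"
    proof (rule dyadic_increments_le[OF \<open>0 < d\<close> cont _ t])
      fix m j :: nat assume "j < 2 ^ m"
      then show "\<bar>Z (u + real (Suc j) * d / 2 ^ m) \<omega> - Z (u + real j * d / 2 ^ m) \<omega>\<bar> \<le> c * (3 / 4) ^ m"
        using \<omega> by (force simp: E_def D_def \<tau>_def)
    qed
    then show "\<bar>Z t \<omega> - Z u \<omega>\<bar> \<le> 12 * y * sqrt (b * d)"
      by (simp add: c_def)
  qed
qed

section \<open>Finite sums of Wiener increments\<close>

text \<open>The intervals in the list may overlap and come in any order. Linear combinations over
  different partitions are then mere concatenations, and a common refinement is built only when the
  variance is computed.\<close>

definition increment_sum :: "(real \<Rightarrow> real) \<Rightarrow> (real \<times> real \<times> real) list \<Rightarrow> real" where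
  "increment_sum w xs = (\<Sum>(c, a, b)\<leftarrow>xs. c * (w b - w a))"

definition interval_step :: "(real \<times> real \<times> real) list \<Rightarrow> real \<Rightarrow> real" where
  "interval_step xs s = (\<Sum>(c, a, b)\<leftarrow>xs. c * indicator {a<..b} s)"

definition unit_intervals :: "(real \<times> real \<times> real) list \<Rightarrow> bool" where
  "unit_intervals xs \<longleftrightarrow> (\<forall>(c, a, b)\<in>set xs. 0 \<le> a \<and> a \<le> b \<and> b \<le> 1)"

lemma increment_sum_append: "increment_sum w (xs @ ys) = increment_sum w xs + increment_sum w ys"
  by (simp add: increment_sum_def)

lemma interval_step_append: "interval_step (xs @ ys) s = interval_step xs s + interval_step ys s"
  by (simp add: interval_step_def)

lemma increment_sum_uminus: "increment_sum w (map (\<lambda>(c, ab). (- c, ab)) xs) = - increment_sum w xs"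
  by (induction xs) (auto simp: increment_sum_def)

lemma interval_step_uminus: "interval_step (map (\<lambda>(c, ab). (- c, ab)) xs) s = - interval_step xs s"
  by (induction xs) (auto simp: interval_step_def)

lemma borel_measurable_interval_step[measurable]: "interval_step xs \<in> borel_measurable borel"
  by (induction xs) (auto simp: interval_step_def[abs_def])

lemma indicator_Ioc_eq_sum:
  fixes g :: "nat \<Rightarrow> real"
  assumes "\<And>l. g l \<le> g (Suc l)" "i \<le> j"
  shows "indicator {g i<..g j} s = (\<Sum>l\<in>{i..<j}. indicator {g l<..g (Suc l)} s :: real)"
  using \<open>i \<le> j\<close>
proof (induction j rule: dec_induct)
  case (step n)
  have "g i \<le> g n" using lift_Suc_mono_le[of g, OF assms(1) step(1)] .
  with assms(1)[of n] have "indicator {g i<..g (Suc n)} s =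
      (indicator {g i<..g n} s + indicator {g n<..g (Suc n)} s :: real)"
    by (auto simp: indicator_def)
  with step show ?case by simp
qed simp

text \<open>Independence of Wiener increments is available along ordered grids only. The sorted
  endpoints of all intervals form such a grid, and every interval is a union of consecutive
  cells.\<close>

lemma increment_sum_common_grid:
  assumes xs: "unit_intervals xs"
  obtains g :: "nat \<Rightarrow> real" and m :: nat and d :: "nat \<Rightarrow> real"
  where "mono_on {..m} g" "g ` {..m} \<subseteq> {0..1}"
    and "\<And>w. increment_sum w xs = (\<Sum>l<m. d l * (w (g (Suc l)) - w (g l)))"
    and "\<And>s. interval_step xs s = (\<Sum>l<m. d l * indicator {g l<..g (Suc l)} s)"
proof -
  define T where "T = (\<Union>(c, a, b)\<in>set xs. {a, b})"
  define G where "G = sorted_list_of_set T"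
  have T: "finite T" "T \<subseteq> {0..1}"
    using xs by (fastforce simp: T_def unit_intervals_def)+
  define m where "m = length G - 1"
  \<comment> \<open>The default 1 keeps \<open>g\<close> monotone with values in the unit interval
    on all natural numbers.\<close>
  define g where "g l = (if l < length G then G ! l else 1)" for l
  have G: "sorted G" "set G = T"
    using T by (auto simp: G_def)
  have g_range: "g l \<in> {0..1}" for l
    using T(2) nth_mem[of l G] unfolding G(2) by (auto simp: g_def subset_iff)
  have g_mono: "g i \<le> g j" if "i \<le> j" for i j
    using that G sorted_nth_mono[OF G(1), of i j] g_range[of i] by (auto simp: g_def)
  have index: "\<exists>i j. i \<le> j \<and> j \<le> m \<and> a = g i \<and> b = g j" if "(c, a, b) \<in> set xs" for c a b
  proof -
    have "a \<in> set G" "b \<in> set G"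
      using that by (force simp: G T_def)+
    then obtain i j where ij: "i < length G" "G ! i = a" "j < length G" "G ! j = b"
      by (auto simp: in_set_conv_nth)
    show ?thesis
    proof (cases "i \<le> j")
      case True
      then show ?thesis using ij by (intro exI[of _ i] exI[of _ j]) (auto simp: g_def m_def)
    next
      \<comment> \<open>Reversed positions are possible only for a degenerate interval, which is
        represented by an empty range of cells.\<close>
      case False
      then have "a = b"
        using sorted_nth_mono[OF G(1), of j i] ij xs that by (auto simp: unit_intervals_def)
      then show ?thesis using ij by (intro exI[of _ i] exI[of _ i]) (auto simp: g_def m_def)
    qed
  qed
  \<comment> \<open>The induction runs over lists with entries from \<open>xs\<close>, so that the
    grid built from all of \<open>xs\<close> stays fixed.\<close>
  have "\<exists>d. (\<forall>w. increment_sum w ys = (\<Sum>l<m. d l * (w (g (Suc l)) - w (g l)))) \<and>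
      (\<forall>s. interval_step ys s = (\<Sum>l<m. d l * indicator {g l<..g (Suc l)} s))"
    if "set ys \<subseteq> set xs" for ys
    using that
  proof (induction ys)
    case Nil
    then show ?case
      by (intro exI[of _ "\<lambda>_. 0"]) (simp add: increment_sum_def interval_step_def)
  next
    case (Cons z ys)
    obtain c a b where z: "z = (c, a, b)" by (cases z)
    from Cons obtain d where d: "\<And>w. increment_sum w ys = (\<Sum>l<m. d l * (w (g (Suc l)) - w (g l)))"
      "\<And>s. interval_step ys s = (\<Sum>l<m. d l * indicator {g l<..g (Suc l)} s)"
      by auto
    from index[of c a b] Cons.prems z obtain i j
      where ij: "i \<le> j" "j \<le> m" "a = g i" "b = g j" by auto
    define e where "e l = (if l \<in> {i..<j} then c else 0)" for l
    have e: "(\<Sum>l<m. e l * F l) = c * (\<Sum>l\<in>{i..<j}. F l)" for F :: "nat \<Rightarrow> real"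
    proof -
      have "(\<Sum>l<m. e l * F l) = (\<Sum>l\<in>{i..<j}. e l * F l)"
        using ij by (intro sum.mono_neutral_right) (auto simp: e_def)
      then show ?thesis by (simp add: e_def sum_distrib_left)
    qed
    have tele: "w b - w a = (\<Sum>l\<in>{i..<j}. w (g (Suc l)) - w (g l))" for w :: "real \<Rightarrow> real"
      using sum_Suc_diff'[of i j "\<lambda>l. w (g l)"] ij by simp
    have ind: "indicator {a<..b} s = (\<Sum>l\<in>{i..<j}. indicator {g l<..g (Suc l)} s :: real)" for s
      using indicator_Ioc_eq_sum[of g i j s] ij g_mono by simp
    show ?case
    proof (intro exI[of _ "\<lambda>l. d l + e l"] conjI allI)
      fix w
      show "increment_sum w (z # ys) = (\<Sum>l<m. (d l + e l) * (w (g (Suc l)) - w (g l)))"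
        using d(1)[of w] by (simp add: increment_sum_def z distrib_right sum.distrib e tele)
    next
      fix s
      show "interval_step (z # ys) s = (\<Sum>l<m. (d l + e l) * indicator {g l<..g (Suc l)} s)"
        using d(2)[of s] by (simp add: interval_step_def z distrib_right sum.distrib e ind)
    qed
  qed
  then obtain d where d: "\<And>w. increment_sum w xs = (\<Sum>l<m. d l * (w (g (Suc l)) - w (g l)))"
      "\<And>s. interval_step xs s = (\<Sum>l<m. d l * indicator {g l<..g (Suc l)} s)"
    by blast
  show thesis
  proof (rule that[of m g d])
    show "mono_on {..m} g" using g_mono by (intro mono_onI)
    show "g ` {..m} \<subseteq> {0..1}" using g_range by blast
  qed (rule d)+
qed

text \<open>The isometry for step functions, together with normality. Variance zero is a separate
  case because a point mass at 0 has no density.\<close>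

lemma (in prob_space) increment_sum_normal:
  assumes W: "wiener_process M W" and xs: "unit_intervals xs"
  obtains v where "0 \<le> v" "(\<integral>\<^sup>+s. ennreal ((interval_step xs s)\<^sup>2) \<partial>lborel) = ennreal v"
    and "0 < v \<Longrightarrow> distributed M lborel (\<lambda>\<omega>. increment_sum (\<lambda>t. W t \<omega>) xs) (normal_density 0 (sqrt v))"
    and "v = 0 \<Longrightarrow> \<forall>\<omega>. increment_sum (\<lambda>t. W t \<omega>) xs = 0"
proof -
  obtain g m d where g: "mono_on {..m} g" "g ` {..m} \<subseteq> {0..1}"
    and incr: "\<And>w. increment_sum w xs = (\<Sum>l<m. d l * (w (g (Suc l)) - w (g l)))"
    and step: "\<And>s. interval_step xs s = (\<Sum>l<m. d l * indicator {g l<..g (Suc l)} s)"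
    by (rule increment_sum_common_grid[OF xs]) (rule that)
  have g_mono: "g i \<le> g j" if "i \<le> j" "j \<le> m" for i j
    using g(1) that by (auto simp: mono_on_def)
  \<comment> \<open>Only cells of positive length with nonzero coefficient carry a nondegenerate
    normal variable; the others contribute nothing to the sum and, up to empty intervals, nothing to
    the step function.\<close>
  define I where "I = {l. l < m \<and> d l \<noteq> 0 \<and> g l < g (Suc l)}"
  define v where "v = (\<Sum>l\<in>I. (d l)\<^sup>2 * (g (Suc l) - g l))"
  have I: "finite I" "I \<subseteq> {..<m}" by (auto simp: I_def)
  have outside: "d l = 0 \<or> g (Suc l) = g l" if "l < m" "l \<notin> I" for l
    using that g_mono[of l "Suc l"] by (auto simp: I_def)
  have incr_I: "increment_sum w xs = (\<Sum>l\<in>I. d l * (w (g (Suc l)) - w (g l)))" for w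
    unfolding incr
    by (intro sum.mono_neutral_right ballI) (use I outside in \<open>fastforce+\<close>)
  have step_I: "interval_step xs s = (\<Sum>l\<in>I. d l * indicator {g l<..g (Suc l)} s)" for s
    unfolding step
    by (intro sum.mono_neutral_right ballI) (use I outside in \<open>fastforce+\<close>)
  \<comment> \<open>Disjoint cells annihilate the cross terms, so squaring the step function squares
    the coefficients.\<close>
  have disj: "indicator {g k<..g (Suc k)} s * indicator {g l<..g (Suc l)} s = (0 :: real)"
    if "k \<in> I" "l \<in> I" "k \<noteq> l" for k l s
    using that g_mono[of "Suc k" l] g_mono[of "Suc l" k] I
    by (cases k l rule: linorder_cases) (auto simp: indicator_def I_def)
  have step_sq: "(interval_step xs s)\<^sup>2 = (\<Sum>l\<in>I. (d l)\<^sup>2 * indicator {g l<..g (Suc l)} s)" for s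
  proof -
    have "(interval_step xs s)\<^sup>2 = (\<Sum>k\<in>I. \<Sum>l\<in>I. d k * d l *
        (indicator {g k<..g (Suc k)} s * indicator {g l<..g (Suc l)} s))"
      by (simp add: step_I power2_eq_square sum_product mult_ac)
    also have "\<dots> = (\<Sum>k\<in>I. \<Sum>l\<in>I. if l = k then (d k)\<^sup>2 * indicator {g k<..g (Suc k)} s else 0)"
      using disj by (intro sum.cong refl) (auto simp: power2_eq_square indicator_def)
    finally show ?thesis using I by simp
  qed
  have pos: "0 < (d l)\<^sup>2 * (g (Suc l) - g l)" if "l \<in> I" for l
    using that by (auto simp: I_def)
  have "(\<integral>\<^sup>+s. ennreal ((interval_step xs s)\<^sup>2) \<partial>lborel)
      = (\<integral>\<^sup>+s. (\<Sum>l\<in>I. ennreal ((d l)\<^sup>2) * indicator {g l<..g (Suc l)} s) \<partial>lborel)"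
  proof (rule nn_integral_cong)
    fix s
    have "ennreal ((interval_step xs s)\<^sup>2)
        = (\<Sum>l\<in>I. ennreal ((d l)\<^sup>2 * indicator {g l<..g (Suc l)} s))"
      unfolding step_sq by (rule sum_ennreal[symmetric]) simp
    also have "\<dots> = (\<Sum>l\<in>I. ennreal ((d l)\<^sup>2) * indicator {g l<..g (Suc l)} s)"
      by (intro sum.cong refl) (auto simp: indicator_def)
    finally show "ennreal ((interval_step xs s)\<^sup>2)
        = (\<Sum>l\<in>I. ennreal ((d l)\<^sup>2) * indicator {g l<..g (Suc l)} s)" .
  qed
  also have "\<dots> = (\<Sum>l\<in>I. ennreal ((d l)\<^sup>2) * ennreal (g (Suc l) - g l))"
    by (subst nn_integral_sum) (auto simp: nn_integral_cmult_indicator I_def intro!: sum.cong)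
  also have "\<dots> = (\<Sum>l\<in>I. ennreal ((d l)\<^sup>2 * (g (Suc l) - g l)))"
    by (intro sum.cong refl) (auto simp: I_def ennreal_mult)
  also have "\<dots> = ennreal v"
    unfolding v_def using pos by (intro sum_ennreal) (simp add: less_imp_le)
  finally have int: "(\<integral>\<^sup>+s. ennreal ((interval_step xs s)\<^sup>2) \<partial>lborel) = ennreal v" .
  have distr: "distributed M lborel (\<lambda>\<omega>. increment_sum (\<lambda>t. W t \<omega>) xs) (normal_density 0 (sqrt v))"
    if "0 < v"
  proof -
    have "I \<noteq> {}" using that by (auto simp: v_def)
    let ?X = "\<lambda>l \<omega>. d l * (W (g (Suc l)) \<omega> - W (g l) \<omega>)"
    have "indep_vars (\<lambda>_. borel) (\<lambda>l \<omega>. W (g (Suc l)) \<omega> - W (g l) \<omega>) {..<m}"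
      using W g by (auto simp: wiener_process_def)
    then have indep: "indep_vars (\<lambda>_. borel) ?X I"
      by (intro indep_vars_compose2[where Y="\<lambda>l x. d l * x" and M'="\<lambda>_. borel"] indep_vars_subset[OF _ I(2)])
         auto
    have "distributed M lborel (?X l) (normal_density 0 (\<bar>d l\<bar> * sqrt (g (Suc l) - g l)))"
      if "l \<in> I" for l
    proof -
      have "0 \<le> g l" "g (Suc l) \<le> 1" "g l < g (Suc l)" "d l \<noteq> 0"
        using that g(2) by (auto simp: I_def image_subset_iff)
      moreover from this have "distributed M lborel (\<lambda>\<omega>. W (g (Suc l)) \<omega> - W (g l) \<omega>)
          (normal_density 0 (sqrt (g (Suc l) - g l)))"
        using W by (auto simp: wiener_process_def)
      ultimately show ?thesis
        using normal_density_affine[of "\<lambda>\<omega>. W (g (Suc l)) \<omega> - W (g l) \<omega>" 0 "sqrt (g (Suc l) - g l)" "d l" 0]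
        by simp
    qed
    from sum_indep_normal[OF I(1) \<open>I \<noteq> {}\<close> indep _ this]
    have "distributed M lborel (\<lambda>\<omega>. \<Sum>l\<in>I. ?X l \<omega>)
        (normal_density (\<Sum>l\<in>I. 0) (sqrt (\<Sum>l\<in>I. (\<bar>d l\<bar> * sqrt (g (Suc l) - g l))\<^sup>2)))"
      by (simp add: I_def)
    also have "(\<Sum>l\<in>I. (\<bar>d l\<bar> * sqrt (g (Suc l) - g l))\<^sup>2) = v"
      unfolding v_def by (intro sum.cong) (auto simp: power_mult_distrib I_def)
    finally show ?thesis by (simp add: incr_I)
  qed
  have zero: "increment_sum (\<lambda>t. W t \<omega>) xs = 0" if "v = 0" for \<omega>
  proof -
    have "0 < v" if "I \<noteq> {}"
      unfolding v_def using I(1) that pos by (rule sum_pos)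
    with that have "I = {}" by auto
    then show ?thesis by (simp add: incr_I)
  qed
  have "0 \<le> v" unfolding v_def using pos by (intro sum_nonneg) (auto simp: less_imp_le)
  from that[OF this int distr] zero show thesis by blast
qed

section \<open>Wiener integrals as limits of increment sums\<close>

text \<open>Integrands live on the whole line instead of \<open>[0, t]\<close>, with the cut-off
  built into \<open>f\<close>. Integrals with different upper limits can then be subtracted, which
  is what increments of the remainder require.\<close>

definition wiener_approx :: "'a measure \<Rightarrow> (real \<Rightarrow> 'a \<Rightarrow> real) \<Rightarrow> (real \<Rightarrow> real) \<Rightarrow> ('a \<Rightarrow> real) \<Rightarrow> bool" where
  "wiener_approx M W f Z \<longleftrightarrow> f \<in> borel_measurable borel \<and> Z \<in> borel_measurable M \<and>
     (\<exists>xs. (\<forall>k. unit_intervals (xs k)) \<and>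
       (\<lambda>k. \<integral>\<^sup>+s. ennreal ((f s - interval_step (xs k) s)\<^sup>2) \<partial>lborel) \<longlonglongrightarrow> 0 \<and>
       (\<lambda>k. \<integral>\<^sup>+\<omega>. ennreal ((Z \<omega> - increment_sum (\<lambda>t. W t \<omega>) (xs k))\<^sup>2) \<partial>M) \<longlonglongrightarrow> 0)"

lemma borel_measurable_increment_sum:
  assumes "wiener_process M W" "unit_intervals xs"
  shows "(\<lambda>\<omega>. increment_sum (\<lambda>t. W t \<omega>) xs) \<in> borel_measurable M"
  using assms(2)
proof (induction xs)
  case (Cons z xs)
  obtain c a b where z: "z = (c, a, b)" by (cases z)
  have [measurable]: "W a \<in> borel_measurable M" "W b \<in> borel_measurable M"
    using assms(1) Cons.prems by (auto simp: wiener_process_def unit_intervals_def z)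
  have "(\<lambda>\<omega>. increment_sum (\<lambda>t. W t \<omega>) xs) \<in> borel_measurable M"
    using Cons by (auto simp: unit_intervals_def)
  then show ?case by (simp add: increment_sum_def z)
qed (simp add: increment_sum_def)

lemma ennreal_square_diff_le:
  fixes a b :: real
  shows "ennreal ((a - b)\<^sup>2) \<le> 2 * ennreal (a\<^sup>2) + 2 * ennreal (b\<^sup>2)"
proof -
  have "(a - b)\<^sup>2 \<le> 2 * a\<^sup>2 + 2 * b\<^sup>2"
    using zero_le_power2[of "a + b"] by (simp add: power2_eq_square algebra_simps)
  then have "ennreal ((a - b)\<^sup>2) \<le> ennreal (2 * a\<^sup>2 + 2 * b\<^sup>2)"
    by (rule ennreal_leI)
  also have "\<dots> = 2 * ennreal (a\<^sup>2) + 2 * ennreal (b\<^sup>2)"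
    by (simp add: ennreal_plus ennreal_mult)
  finally show ?thesis .
qed

text \<open>A crude replacement for the triangle inequality in \<open>L^2\<close> that stays within
  nonnegative integrals. Its factors 2 are one source of the constants 8 and 24 below.\<close>

lemma nn_integral_square_diff_le:
  fixes f g :: "'b \<Rightarrow> real"
  assumes [measurable]: "f \<in> borel_measurable N" "g \<in> borel_measurable N"
  shows "(\<integral>\<^sup>+x. ennreal ((f x - g x)\<^sup>2) \<partial>N)
    \<le> 2 * (\<integral>\<^sup>+x. ennreal ((f x)\<^sup>2) \<partial>N) + 2 * (\<integral>\<^sup>+x. ennreal ((g x)\<^sup>2) \<partial>N)"
proof -
  have "(\<integral>\<^sup>+x. ennreal ((f x - g x)\<^sup>2) \<partial>N)
      \<le> (\<integral>\<^sup>+x. 2 * ennreal ((f x)\<^sup>2) + 2 * ennreal ((g x)\<^sup>2) \<partial>N)"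
    by (intro nn_integral_mono ennreal_square_diff_le)
  then show ?thesis by (simp add: nn_integral_add nn_integral_cmult)
qed

lemma tendsto_ennreal_two_sum:
  fixes F G H :: "nat \<Rightarrow> ennreal"
  assumes "F \<longlonglongrightarrow> 0" "G \<longlonglongrightarrow> 0" "\<And>k. H k \<le> 2 * F k + 2 * G k"
  shows "H \<longlonglongrightarrow> 0"
proof -
  have "(\<lambda>k. 2 * F k + 2 * G k) \<longlonglongrightarrow> 2 * 0 + 2 * 0"
    by (intro tendsto_add ennreal_tendsto_cmult assms) auto
  then show ?thesis
    using assms(3) by (intro tendsto_sandwich[OF _ _ tendsto_const, of 0 H _ "\<lambda>k. 2 * F k + 2 * G k"]) auto
qed

lemma wiener_approx_diff:
  assumes W: "wiener_process M W" and "wiener_approx M W f Z" "wiener_approx M W g V"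
  shows "wiener_approx M W (\<lambda>s. f s - g s) (\<lambda>\<omega>. Z \<omega> - V \<omega>)"
proof -
  have [measurable]: "f \<in> borel_measurable borel" "Z \<in> borel_measurable M"
      "g \<in> borel_measurable borel" "V \<in> borel_measurable M"
    using assms by (auto simp: wiener_approx_def)
  obtain xs where xs: "\<And>k. unit_intervals (xs k)"
    "(\<lambda>k. \<integral>\<^sup>+s. ennreal ((f s - interval_step (xs k) s)\<^sup>2) \<partial>lborel) \<longlonglongrightarrow> 0"
    "(\<lambda>k. \<integral>\<^sup>+\<omega>. ennreal ((Z \<omega> - increment_sum (\<lambda>t. W t \<omega>) (xs k))\<^sup>2) \<partial>M) \<longlonglongrightarrow> 0"
    using assms(2) by (auto simp: wiener_approx_def)
  obtain ys where ys: "\<And>k. unit_intervals (ys k)"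
    "(\<lambda>k. \<integral>\<^sup>+s. ennreal ((g s - interval_step (ys k) s)\<^sup>2) \<partial>lborel) \<longlonglongrightarrow> 0"
    "(\<lambda>k. \<integral>\<^sup>+\<omega>. ennreal ((V \<omega> - increment_sum (\<lambda>t. W t \<omega>) (ys k))\<^sup>2) \<partial>M) \<longlonglongrightarrow> 0"
    using assms(3) by (auto simp: wiener_approx_def)
  define zs where "zs k = xs k @ map (\<lambda>(c, ab). (- c, ab)) (ys k)" for k
  note [measurable] = borel_measurable_increment_sum[OF W xs(1)] borel_measurable_increment_sum[OF W ys(1)]
  have "(\<lambda>k. \<integral>\<^sup>+s. ennreal ((f s - g s - interval_step (zs k) s)\<^sup>2) \<partial>lborel) \<longlonglongrightarrow> 0"
  proof (rule tendsto_ennreal_two_sum[OF xs(2) ys(2)])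
    fix k
    have "f s - g s - interval_step (zs k) s
        = (f s - interval_step (xs k) s) - (g s - interval_step (ys k) s)" for s
      by (simp add: zs_def interval_step_append interval_step_uminus)
    then show "(\<integral>\<^sup>+s. ennreal ((f s - g s - interval_step (zs k) s)\<^sup>2) \<partial>lborel)
      \<le> 2 * (\<integral>\<^sup>+s. ennreal ((f s - interval_step (xs k) s)\<^sup>2) \<partial>lborel) +
        2 * (\<integral>\<^sup>+s. ennreal ((g s - interval_step (ys k) s)\<^sup>2) \<partial>lborel)"
      by (simp only:) (intro nn_integral_square_diff_le; measurable)
  qed
  moreover have "(\<lambda>k. \<integral>\<^sup>+\<omega>. ennreal ((Z \<omega> - V \<omega> - increment_sum (\<lambda>t. W t \<omega>) (zs k))\<^sup>2) \<partial>M) \<longlonglongrightarrow> 0"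
  proof (rule tendsto_ennreal_two_sum[OF xs(3) ys(3)])
    fix k
    have "Z \<omega> - V \<omega> - increment_sum (\<lambda>t. W t \<omega>) (zs k)
        = (Z \<omega> - increment_sum (\<lambda>t. W t \<omega>) (xs k)) - (V \<omega> - increment_sum (\<lambda>t. W t \<omega>) (ys k))" for \<omega>
      by (simp add: zs_def increment_sum_append increment_sum_uminus)
    then show "(\<integral>\<^sup>+\<omega>. ennreal ((Z \<omega> - V \<omega> - increment_sum (\<lambda>t. W t \<omega>) (zs k))\<^sup>2) \<partial>M)
      \<le> 2 * (\<integral>\<^sup>+\<omega>. ennreal ((Z \<omega> - increment_sum (\<lambda>t. W t \<omega>) (xs k))\<^sup>2) \<partial>M) +
        2 * (\<integral>\<^sup>+\<omega>. ennreal ((V \<omega> - increment_sum (\<lambda>t. W t \<omega>) (ys k))\<^sup>2) \<partial>M)"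
      by (simp only:) (intro nn_integral_square_diff_le; measurable)
  qed
  moreover have "unit_intervals (zs k)" for k
    using xs(1)[of k] ys(1)[of k] by (auto simp: zs_def unit_intervals_def)
  ultimately show ?thesis
    by (auto simp: wiener_approx_def intro!: exI[of _ zs])
qed

lemma wiener_approx_increment:
  assumes "wiener_process M W" "0 \<le> a" "a \<le> b" "b \<le> 1"
  shows "wiener_approx M W (\<lambda>s. c * indicator {a<..b} s) (\<lambda>\<omega>. c * (W b \<omega> - W a \<omega>))"
proof -
  have [measurable]: "W a \<in> borel_measurable M" "W b \<in> borel_measurable M"
    using assms by (auto simp: wiener_process_def)
  show ?thesis
    using assms unfolding wiener_approx_def
    by (auto intro!: exI[of _ "\<lambda>_. [(c, a, b)]"] simp: unit_intervals_def interval_step_def increment_sum_def)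
qed

lemma wiener_approx_wiener_integral:
  assumes "has_wiener_integral M W t f Y" "0 \<le> t" "t \<le> 1"
  shows "wiener_approx M W (\<lambda>s. f s * indicator {0..t} s) Y"
proof -
  obtain n :: "nat \<Rightarrow> nat" and p c :: "nat \<Rightarrow> nat \<Rightarrow> real" where
    p: "\<And>k. p k 0 = 0" "\<And>k. p k (n k) = t" "\<And>k. mono_on {..n k} (p k)" and
    f: "(\<lambda>k. \<integral>\<^sup>+ s\<in>{0..t}. ennreal ((f s - step_fun (n k) (p k) (c k) s)\<^sup>2) \<partial>lborel) \<longlonglongrightarrow> 0" and
    Y: "(\<lambda>k. \<integral>\<^sup>+ \<omega>. ennreal ((Y \<omega> - wiener_sum W (n k) (p k) (c k) \<omega>)\<^sup>2) \<partial>M) \<longlonglongrightarrow> 0"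
    using assms(1) unfolding has_wiener_integral_def by auto
  define xs where "xs k = map (\<lambda>i. (c k i, p k i, p k (Suc i))) [0..<n k]" for k
  have p_mono: "p k i \<le> p k j" if "i \<le> j" "j \<le> n k" for k i j
    using p(3)[of k] that by (auto simp: mono_on_def)
  have range: "0 \<le> p k i \<and> p k i \<le> t" if "i \<le> n k" for k i
    using p_mono[of 0 i k] p_mono[of i "n k" k] that p(1,2) by auto
  have unit: "unit_intervals (xs k)" for k
    using range[of _ k] p_mono[of _ _ k] \<open>t \<le> 1\<close>
    by (auto simp: unit_intervals_def xs_def) (meson Suc_leI order_trans)
  have incr: "increment_sum (\<lambda>t. W t \<omega>) (xs k) = wiener_sum W (n k) (p k) (c k) \<omega>" for k \<omega>
    by (simp add: increment_sum_def xs_def wiener_sum_def comp_def interv_sum_list_conv_sum_set_nat lessThan_atLeast0)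
  have step: "interval_step (xs k) s = step_fun (n k) (p k) (c k) s" for k s
    by (simp add: interval_step_def xs_def step_fun_def comp_def interv_sum_list_conv_sum_set_nat lessThan_atLeast0)
  \<comment> \<open>The partition runs from 0 to \<open>t\<close>, so extending \<open>f\<close> by
    zero leaves the \<open>L^2\<close> distance to the step functions unchanged.\<close>
  have outside: "step_fun (n k) (p k) (c k) s = 0" if "s \<notin> {0..t}" for k s
  proof -
    have "indicator {p k i<..p k (Suc i)} s = (0 :: real)" if "i < n k" for i
      using range[of i k] range[of "Suc i" k] \<open>s \<notin> {0..t}\<close> that by (auto simp: indicator_def)
    then show ?thesis by (simp add: step_fun_def)
  qed
  have "(\<integral>\<^sup>+s. ennreal ((f s * indicator {0..t} s - interval_step (xs k) s)\<^sup>2) \<partial>lborel)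
      = (\<integral>\<^sup>+ s\<in>{0..t}. ennreal ((f s - step_fun (n k) (p k) (c k) s)\<^sup>2) \<partial>lborel)" for k
    unfolding step using outside by (intro nn_integral_cong) (auto simp: indicator_def)
  moreover have "(\<lambda>s. f s * indicator {0..t} s) \<in> borel_measurable borel" "Y \<in> borel_measurable M"
    using assms(1) by (auto simp: has_wiener_integral_def set_borel_measurable_def mult.commute)
  ultimately show ?thesis
    unfolding wiener_approx_def using unit f Y by (auto intro!: exI[of _ xs] simp: incr)
qed

section \<open>Second moments and tails of the limits\<close>

lemma (in prob_space) normal_second_moment:
  assumes D: "distributed M lborel X (normal_density 0 \<sigma>)" and "0 < \<sigma>"
  shows "(\<integral>\<^sup>+\<omega>. ennreal ((X \<omega>)\<^sup>2) \<partial>M) = ennreal (\<sigma>\<^sup>2)"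
proof -
  have "(\<integral>\<^sup>+\<omega>. ennreal ((X \<omega>)\<^sup>2) \<partial>M) = (\<integral>\<^sup>+y. ennreal (normal_density 0 \<sigma> y) * ennreal (y\<^sup>2) \<partial>lborel)"
    by (rule distributed_nn_integral[OF D, symmetric]) simp
  also have "\<dots> = (\<integral>\<^sup>+y. ennreal (normal_density 0 \<sigma> y * (y - 0)\<^sup>2) \<partial>lborel)"
    by (simp add: ennreal_mult)
  also have "\<dots> = ennreal (\<integral>y. normal_density 0 \<sigma> y * (y - 0)\<^sup>2 \<partial>lborel)"
    using \<open>0 < \<sigma>\<close> by (intro nn_integral_eq_integral integrable_normal_moment) auto
  also have "(\<integral>y. normal_density 0 \<sigma> y * (y - 0)\<^sup>2 \<partial>lborel) = \<sigma>\<^sup>2"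
    using integral_normal_moment_even[OF \<open>0 < \<sigma>\<close>, of 0 1] by simp
  finally show ?thesis .
qed

text \<open>Gaussian bounds survive the \<open>L^2\<close> limit. The step functions eventually have
  squared norm at most \<open>2 v + 2 (v / 2) = 3 v\<close>, so the approximating sums are normal
  with variance at most \<open>3 v\<close>. Giving half of \<open>x\<close> to the sum yields the
  exponent \<open>(x / 2)^2 / (6 v) = x^2 / (24 v)\<close>, and the half given to the error vanishes
  in the limit by Chebyshev. The 8 is \<open>2 + 2 * 3\<close>.\<close>

lemma (in prob_space) wiener_approx_bounds:
  assumes W: "wiener_process M W" and Z: "wiener_approx M W f Z"
    and v: "0 < v" "(\<integral>\<^sup>+s. ennreal ((f s)\<^sup>2) \<partial>lborel) \<le> ennreal v"
  shows wiener_approx_tail: "0 < x \<Longrightarrow> prob {\<omega> \<in> space M. x \<le> \<bar>Z \<omega>\<bar>} \<le> 2 * exp (- x\<^sup>2 / (24 * v))"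
    and wiener_approx_second_moment: "(\<integral>\<^sup>+\<omega>. ennreal ((Z \<omega>)\<^sup>2) \<partial>M) \<le> ennreal (8 * v)"
proof -
  have [measurable]: "f \<in> borel_measurable borel" "Z \<in> borel_measurable M"
    using Z by (auto simp: wiener_approx_def)
  obtain xs where xs: "\<And>k. unit_intervals (xs k)"
    and f_lim: "(\<lambda>k. \<integral>\<^sup>+s. ennreal ((f s - interval_step (xs k) s)\<^sup>2) \<partial>lborel) \<longlonglongrightarrow> 0"
    and Z_lim: "(\<lambda>k. \<integral>\<^sup>+\<omega>. ennreal ((Z \<omega> - increment_sum (\<lambda>t. W t \<omega>) (xs k))\<^sup>2) \<partial>M) \<longlonglongrightarrow> 0"
    using Z by (auto simp: wiener_approx_def)
  define S where "S k \<omega> = increment_sum (\<lambda>t. W t \<omega>) (xs k)" for k \<omega>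
  have [measurable]: "S k \<in> borel_measurable M" for k
    unfolding S_def using borel_measurable_increment_sum[OF W xs] by simp
  define \<Delta> where "\<Delta> k = (\<integral>\<^sup>+\<omega>. ennreal ((Z \<omega> - S k \<omega>)\<^sup>2) \<partial>M)" for k
  have \<Delta>: "\<Delta> \<longlonglongrightarrow> 0" using Z_lim by (simp add: \<Delta>_def[abs_def] S_def)
  have "\<forall>\<^sub>F k in sequentially. (\<integral>\<^sup>+s. ennreal ((f s - interval_step (xs k) s)\<^sup>2) \<partial>lborel) < ennreal (v / 2)"
    using order_tendstoD(2)[OF f_lim, of "ennreal (v / 2)"] \<open>0 < v\<close> by simp
  then have var: "\<forall>\<^sub>F k in sequentially. (\<integral>\<^sup>+s. ennreal ((interval_step (xs k) s)\<^sup>2) \<partial>lborel) \<le> ennreal (3 * v)"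
  proof eventually_elim
    case (elim k)
    have "(\<integral>\<^sup>+s. ennreal ((interval_step (xs k) s)\<^sup>2) \<partial>lborel)
        = (\<integral>\<^sup>+s. ennreal ((f s - (f s - interval_step (xs k) s))\<^sup>2) \<partial>lborel)"
      by simp
    also have "\<dots> \<le> 2 * (\<integral>\<^sup>+s. ennreal ((f s)\<^sup>2) \<partial>lborel)
        + 2 * (\<integral>\<^sup>+s. ennreal ((f s - interval_step (xs k) s)\<^sup>2) \<partial>lborel)"
      by (intro nn_integral_square_diff_le; measurable)
    also have "\<dots> \<le> 2 * ennreal v + 2 * ennreal (v / 2)"
      using elim v by (intro add_mono mult_left_mono) auto
    also have "\<dots> = ennreal (2 * v + 2 * (v / 2))"
      using \<open>0 < v\<close> by (simp only: ennreal_plus ennreal_mult' zero_le_numeral ennreal_numeral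
        mult_nonneg_nonneg less_imp_le half_gt_zero)
    finally show ?case by simp
  qed
  have S_bounds: "\<forall>\<^sub>F k in sequentially. (\<integral>\<^sup>+\<omega>. ennreal ((S k \<omega>)\<^sup>2) \<partial>M) \<le> ennreal (3 * v) \<and>
      (\<forall>y>0. prob {\<omega> \<in> space M. y \<le> \<bar>S k \<omega>\<bar>} \<le> 2 * exp (- y\<^sup>2 / (6 * v)))"
    using var
  proof eventually_elim
    case (elim k)
    obtain w where w: "0 \<le> w" "(\<integral>\<^sup>+s. ennreal ((interval_step (xs k) s)\<^sup>2) \<partial>lborel) = ennreal w"
      and normal: "0 < w \<Longrightarrow>
        distributed M lborel (\<lambda>\<omega>. increment_sum (\<lambda>t. W t \<omega>) (xs k)) (normal_density 0 (sqrt w))"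
      and zero: "w = 0 \<Longrightarrow> \<forall>\<omega>. increment_sum (\<lambda>t. W t \<omega>) (xs k) = 0"
      by (rule increment_sum_normal[OF W xs[of k]]) (rule that)
    note zero = zero[folded S_def]
    have "w \<le> 3 * v" using elim w \<open>0 < v\<close> by simp
    show ?case
    proof (cases "w = 0")
      case True
      then show ?thesis using zero \<open>0 < v\<close> by simp
    next
      case False
      then have "0 < w" using w by simp
      have D: "distributed M lborel (S k) (normal_density 0 (sqrt w))"
        using normal[OF \<open>0 < w\<close>] by (simp add: S_def[abs_def])
      have "prob {\<omega> \<in> space M. y \<le> \<bar>S k \<omega>\<bar>} \<le> 2 * exp (- y\<^sup>2 / (6 * v))" if "0 < y" for y
      proof -
        have "prob {\<omega> \<in> space M. y \<le> \<bar>S k \<omega>\<bar>} \<le> 2 * exp (- y\<^sup>2 / (2 * w))"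
          using normal_abs_tail_le[OF D, of y] that \<open>0 < w\<close> by simp
        also have "\<dots> \<le> 2 * exp (- y\<^sup>2 / (6 * v))"
          using \<open>w \<le> 3 * v\<close> \<open>0 < w\<close> \<open>0 < v\<close> by (simp add: frac_le)
        finally show ?thesis .
      qed
      moreover have "(\<integral>\<^sup>+\<omega>. ennreal ((S k \<omega>)\<^sup>2) \<partial>M) \<le> ennreal (3 * v)"
        using normal_second_moment[OF D] \<open>0 < w\<close> \<open>w \<le> 3 * v\<close> by (simp add: ennreal_leI)
      ultimately show ?thesis by blast
    qed
  qed
  show "(\<integral>\<^sup>+\<omega>. ennreal ((Z \<omega>)\<^sup>2) \<partial>M) \<le> ennreal (8 * v)"
  proof -
    have "\<forall>\<^sub>F k in sequentially. \<Delta> k < ennreal v"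
      using order_tendstoD(2)[OF \<Delta>, of "ennreal v"] \<open>0 < v\<close> by simp
    from eventually_conj[OF this S_bounds] obtain k
      where k: "\<Delta> k < ennreal v" "(\<integral>\<^sup>+\<omega>. ennreal ((S k \<omega>)\<^sup>2) \<partial>M) \<le> ennreal (3 * v)"
      by (auto simp: eventually_sequentially)
    have "(\<integral>\<^sup>+\<omega>. ennreal ((Z \<omega>)\<^sup>2) \<partial>M) = (\<integral>\<^sup>+\<omega>. ennreal (((Z \<omega> - S k \<omega>) - (- S k \<omega>))\<^sup>2) \<partial>M)"
      by simp
    also have "\<dots> \<le> 2 * (\<integral>\<^sup>+\<omega>. ennreal ((Z \<omega> - S k \<omega>)\<^sup>2) \<partial>M) + 2 * (\<integral>\<^sup>+\<omega>. ennreal ((- S k \<omega>)\<^sup>2) \<partial>M)"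
      by (intro nn_integral_square_diff_le; measurable)
    also have "\<dots> \<le> 2 * ennreal v + 2 * ennreal (3 * v)"
      using k by (intro add_mono mult_left_mono) (auto simp: \<Delta>_def)
    also have "\<dots> = ennreal (2 * v + 2 * (3 * v))"
      using \<open>0 < v\<close> by (simp only: ennreal_plus ennreal_mult' zero_le_numeral ennreal_numeral
        mult_nonneg_nonneg less_imp_le)
    finally show ?thesis by simp
  qed
  assume "0 < x"
  have "\<forall>\<^sub>F k in sequentially. ennreal (prob {\<omega> \<in> space M. x \<le> \<bar>Z \<omega>\<bar>})
      \<le> ennreal (2 * exp (- x\<^sup>2 / (24 * v))) + ennreal (4 / x\<^sup>2) * \<Delta> k"
    using S_bounds
  proof eventually_elim
    case (elim k)
    \<comment> \<open>The second set is the event that the error is at least \<open>x / 2\<close>,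
      squared and scaled into the shape of Markov's inequality.\<close>
    have "emeasure M {\<omega> \<in> space M. x \<le> \<bar>Z \<omega>\<bar>}
        \<le> emeasure M ({\<omega> \<in> space M. x / 2 \<le> \<bar>S k \<omega>\<bar>} \<union>
            {\<omega> \<in> space M. 1 \<le> ennreal (4 / x\<^sup>2) * ennreal ((Z \<omega> - S k \<omega>)\<^sup>2)})"
    proof (intro emeasure_mono subsetI)
      fix \<omega> assume \<omega>: "\<omega> \<in> {\<omega> \<in> space M. x \<le> \<bar>Z \<omega>\<bar>}"
      have "1 \<le> 4 / x\<^sup>2 * (Z \<omega> - S k \<omega>)\<^sup>2" if "\<not> x / 2 \<le> \<bar>S k \<omega>\<bar>"
      proof -
        have "x / 2 \<le> \<bar>Z \<omega> - S k \<omega>\<bar>" using \<omega> that abs_triangle_ineq[of "Z \<omega> - S k \<omega>" "S k \<omega>"] by simp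
        then have "(x / 2)\<^sup>2 \<le> (Z \<omega> - S k \<omega>)\<^sup>2"
          using \<open>0 < x\<close> by (simp add: abs_le_square_iff[symmetric])
        then show ?thesis using \<open>0 < x\<close> by (simp add: field_simps power2_eq_square)
      qed
      then show "\<omega> \<in> {\<omega> \<in> space M. x / 2 \<le> \<bar>S k \<omega>\<bar>} \<union>
            {\<omega> \<in> space M. 1 \<le> ennreal (4 / x\<^sup>2) * ennreal ((Z \<omega> - S k \<omega>)\<^sup>2)}"
        using \<omega> \<open>0 < x\<close> by (auto simp flip: ennreal_mult)
    qed auto
    also have "\<dots> \<le> emeasure M {\<omega> \<in> space M. x / 2 \<le> \<bar>S k \<omega>\<bar>} +
            emeasure M {\<omega> \<in> space M. 1 \<le> ennreal (4 / x\<^sup>2) * ennreal ((Z \<omega> - S k \<omega>)\<^sup>2)}"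
      by (intro emeasure_subadditive) auto
    also have "\<dots> \<le> ennreal (2 * exp (- x\<^sup>2 / (24 * v))) + ennreal (4 / x\<^sup>2) * \<Delta> k"
    proof (intro add_mono)
      have "prob {\<omega> \<in> space M. x / 2 \<le> \<bar>S k \<omega>\<bar>} \<le> 2 * exp (- (x / 2)\<^sup>2 / (6 * v))"
        using elim[THEN conjunct2, rule_format, of "x / 2"] half_gt_zero[OF \<open>0 < x\<close>] by blast
      then show "emeasure M {\<omega> \<in> space M. x / 2 \<le> \<bar>S k \<omega>\<bar>} \<le> ennreal (2 * exp (- x\<^sup>2 / (24 * v)))"
        by (auto simp: emeasure_eq_measure power_divide intro!: ennreal_leI)
      have "emeasure M ({\<omega> \<in> space M. 1 \<le> ennreal (4 / x\<^sup>2) * ennreal ((Z \<omega> - S k \<omega>)\<^sup>2)} \<inter> space M)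
          \<le> ennreal (4 / x\<^sup>2) * (\<integral>\<^sup>+\<omega>. ennreal ((Z \<omega> - S k \<omega>)\<^sup>2) * indicator (space M) \<omega> \<partial>M)"
        using nn_integral_Markov_inequality[of "\<lambda>\<omega>. ennreal ((Z \<omega> - S k \<omega>)\<^sup>2)" "space M" M "ennreal (4 / x\<^sup>2)"]
        by (simp add: Int_absorb2 conj_commute)
      also have "(\<integral>\<^sup>+\<omega>. ennreal ((Z \<omega> - S k \<omega>)\<^sup>2) * indicator (space M) \<omega> \<partial>M) = \<Delta> k"
        unfolding \<Delta>_def by (intro nn_integral_cong) simp
      finally show "emeasure M {\<omega> \<in> space M. 1 \<le> ennreal (4 / x\<^sup>2) * ennreal ((Z \<omega> - S k \<omega>)\<^sup>2)}
          \<le> ennreal (4 / x\<^sup>2) * \<Delta> k"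
        by (simp add: Int_absorb2)
    qed
    finally show ?case by (simp add: emeasure_eq_measure)
  qed
  moreover have "(\<lambda>k. ennreal (2 * exp (- x\<^sup>2 / (24 * v))) + ennreal (4 / x\<^sup>2) * \<Delta> k)
      \<longlonglongrightarrow> ennreal (2 * exp (- x\<^sup>2 / (24 * v))) + ennreal (4 / x\<^sup>2) * 0"
    by (intro tendsto_intros ennreal_tendsto_cmult \<Delta>) auto
  ultimately have "ennreal (prob {\<omega> \<in> space M. x \<le> \<bar>Z \<omega>\<bar>})
      \<le> ennreal (2 * exp (- x\<^sup>2 / (24 * v))) + ennreal (4 / x\<^sup>2) * 0"
    by (intro tendsto_lowerbound) auto
  then show "prob {\<omega> \<in> space M. x \<le> \<bar>Z \<omega>\<bar>} \<le> 2 * exp (- x\<^sup>2 / (24 * v))"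
    by simp
qed

section \<open>The law of the iterated logarithm for the Wiener process\<close>

lemma (in prob_space) indep_vars_reindex_inj:
  assumes indep: "indep_vars N X K" and f: "inj_on f I" "f ` I \<subseteq> K"
  shows "indep_vars (\<lambda>i. N (f i)) (\<lambda>i. X (f i)) I"
proof -
  have rv: "random_variable (N (f i)) (X (f i))" if "i \<in> I" for i
    using indep f that by (auto simp: indep_vars_def)
  show ?thesis
    unfolding indep_vars_def2
  proof (intro conjI ballI rv indep_setsI)
    fix i assume "i \<in> I"
    then show "{X (f i) -` A \<inter> space M |A. A \<in> sets (N (f i))} \<subseteq> events"
      using rv[of i] by (auto intro: measurable_sets)
  next
    fix A J
    assume J: "J \<noteq> {}" "J \<subseteq> I" "finite J"
      and A: "\<forall>j\<in>J. A j \<in> {X (f j) -` A \<inter> space M |A. A \<in> sets (N (f j))}"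
    from bchoice[of J "\<lambda>j B. A j = X (f j) -` B \<inter> space M \<and> B \<in> sets (N (f j))"] A
    obtain B where B: "\<And>j. j \<in> J \<Longrightarrow> A j = X (f j) -` B j \<inter> space M"
      "\<And>j. j \<in> J \<Longrightarrow> B j \<in> sets (N (f j))"
      by auto
    have inj: "inj_on f J" using f(1) J(2) by (rule inj_on_subset)
    \<comment> \<open>The sets are carried over to the image of \<open>f\<close>, where independence
      of the original family applies.\<close>
    define B' where "B' = B \<circ> the_inv_into J f"
    have B': "B' (f j) = B j" if "j \<in> J" for j
      using the_inv_into_f_f[OF inj that] by (simp add: B'_def)
    have "(\<Inter>j\<in>J. A j) = (\<Inter>k\<in>f ` J. X k -` B' k \<inter> space M)"
      using B(1) B' by auto
    also have "prob \<dots> = (\<Prod>k\<in>f ` J. prob (X k -` B' k \<inter> space M))"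
      using J f(2) B(2) B' by (intro indep_varsD[OF indep]) auto
    also have "\<dots> = (\<Prod>j\<in>J. prob (A j))"
      using B(1) B' by (simp add: prod.reindex[OF inj])
    finally show "prob (\<Inter>j\<in>J. A j) = (\<Prod>j\<in>J. prob (A j))" .
  qed
qed

text \<open>The grids used near the origin decrease forever, while the Wiener property speaks of
  finite increasing ones. Each initial segment is reversed in time, and independence of an infinite
  family is a statement about its finite subfamilies.\<close>

lemma (in prob_space) wiener_decreasing_increments_indep:
  assumes W: "wiener_process M W" and t: "antimono t" "\<And>n::nat. t n \<in> {0..1}"
  shows "indep_vars (\<lambda>_. borel) (\<lambda>n \<omega>. W (t n) \<omega> - W (t (Suc n)) \<omega>) UNIV"
proof -
  let ?X = "\<lambda>n \<omega>. W (t n) \<omega> - W (t (Suc n)) \<omega>"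
  have finite_indep: "indep_vars (\<lambda>_. borel) ?X {..<N}" for N
  proof -
    define p where "p i = t (N - i)" for i
    have "mono_on {..N} p" "p ` {..N} \<subseteq> {0..1}"
      using t by (auto simp: p_def mono_on_def antimono_def)
    then have "indep_vars (\<lambda>_. borel) (\<lambda>i \<omega>. W (p (Suc i)) \<omega> - W (p i) \<omega>) {..<N}"
      using W by (auto simp: wiener_process_def)
    moreover have "inj_on (\<lambda>n. N - Suc n) {..<N}" "(\<lambda>n. N - Suc n) ` {..<N} \<subseteq> {..<N}"
      by (auto simp: inj_on_def)
    ultimately have "indep_vars (\<lambda>_. borel) (\<lambda>n \<omega>. W (p (Suc (N - Suc n))) \<omega> - W (p (N - Suc n)) \<omega>) {..<N}"
      by (rule indep_vars_reindex_inj)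
    then show ?thesis
      by (rule indep_vars_cong[THEN iffD1, rotated -1]) (auto simp: p_def Suc_diff_Suc)
  qed
  show ?thesis
    unfolding indep_vars_def2
  proof (intro conjI ballI)
    fix i
    show "random_variable borel (?X i)"
      using finite_indep[of "Suc i"] by (auto simp: indep_vars_def2)
  next
    show "indep_sets (\<lambda>i. {?X i -` A \<inter> space M |A. A \<in> sets borel}) UNIV"
    proof (subst indep_sets_finite_index_sets, intro allI impI)
      fix J :: "nat set" assume "finite J"
      then obtain N where "J \<subseteq> {..<N}" using finite_nat_bounded by blast
      from indep_vars_subset[OF finite_indep this]
      show "indep_sets (\<lambda>i. {?X i -` A \<inter> space M |A. A \<in> sets borel}) J"
        by (simp add: indep_vars_def2)
    qed
  qed
qed

text \<open>The symmetry serves twice: it bounds \<open>W\<close> from below in the lower half of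
  the law, and it covers a negative \<open>K(0,0)\<close>.\<close>

lemma wiener_process_uminus:
  assumes "wiener_process M W"
  shows "wiener_process M (\<lambda>t \<omega>. - W t \<omega>)"
proof -
  interpret prob_space M using assms by (simp add: wiener_process_def)
  have "indep_vars (\<lambda>_. borel) (\<lambda>i \<omega>. - W (p (Suc i)) \<omega> - - W (p i) \<omega>) {..<n}"
    if "mono_on {..n} p" "p ` {..n} \<subseteq> {0..1}" for p :: "nat \<Rightarrow> real" and n
  proof -
    have "indep_vars (\<lambda>_. borel) (\<lambda>i \<omega>. W (p (Suc i)) \<omega> - W (p i) \<omega>) {..<n}"
      using assms that by (auto simp: wiener_process_def)
    from indep_vars_compose2[OF this, of "\<lambda>_ x. - x" "\<lambda>_. borel"] show ?thesis
      by (simp add: algebra_simps)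
  qed
  moreover have "distributed M lborel (\<lambda>\<omega>. - W t \<omega> - - W s \<omega>) (normal_density 0 (sqrt (t - s)))"
    if "0 \<le> s" "s < t" "t \<le> 1" for s t
  proof -
    have "distributed M lborel (\<lambda>\<omega>. W t \<omega> - W s \<omega>) (normal_density 0 (sqrt (t - s)))"
      using assms that by (auto simp: wiener_process_def)
    from normal_density_affine[OF this, of "-1" 0] show ?thesis
      using that by (simp add: algebra_simps)
  qed
  ultimately show ?thesis
    using assms by (auto simp: wiener_process_def intro!: continuous_on_minus)
qed

lemma wiener_increment_normal:
  assumes "wiener_process M W" "0 \<le> s" "s < t" "t \<le> 1"
  shows "distributed M lborel (\<lambda>\<omega>. W t \<omega> - W s \<omega>) (normal_density 0 (sqrt (t - s)))"
  using assms by (auto simp: wiener_process_def)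

lemma (in prob_space) wiener_tail:
  assumes "wiener_process M W" "0 \<le> s" "s < t" "t \<le> 1" "0 < x"
  shows "prob {\<omega> \<in> space M. x \<le> \<bar>W t \<omega> - W s \<omega>\<bar>} \<le> 2 * exp (- x\<^sup>2 / (2 * (t - s)))"
  using normal_abs_tail_le[OF wiener_increment_normal[OF assms(1-4)], of x] assms by simp

text \<open>Chaining on the \<open>n\<close>-th window with \<open>y^2 = 2 ln n\<close> fails with
  probability at most \<open>4 / n^2\<close>, which is summable. The windows are grid cells for
  \<open>W\<close> and intervals starting at 0 for the remainder.\<close>

lemma (in prob_space) eventually_oscillation_le:
  fixes Z :: "real \<Rightarrow> 'a \<Rightarrow> real"
  assumes "0 < b" and d: "\<And>n::nat. 0 < d n"
    and Z: "\<And>n t. N \<le> n \<Longrightarrow> t \<in> {u n..u n + d n} \<Longrightarrow> Z t \<in> borel_measurable M"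
    and tail: "\<And>n s t x. N \<le> n \<Longrightarrow> u n \<le> s \<Longrightarrow> s < t \<Longrightarrow> t \<le> u n + d n \<Longrightarrow> 0 < x \<Longrightarrow>
      prob {\<omega> \<in> space M. x \<le> \<bar>Z t \<omega> - Z s \<omega>\<bar>} \<le> 2 * exp (- x\<^sup>2 / (b * (t - s)))"
    and cont: "AE \<omega> in M. \<forall>n\<ge>N. continuous_on {u n..u n + d n} (\<lambda>t. Z t \<omega>)"
  shows "AE \<omega> in M. \<forall>\<^sub>F n in sequentially. \<forall>t\<in>{u n..u n + d n}.
    \<bar>Z t \<omega> - Z (u n) \<omega>\<bar> \<le> 12 * sqrt (2 * ln (real n)) * sqrt (b * d n)"
proof -
  \<comment> \<open>From 2 on, \<open>ln n\<close> is positive and \<open>4 / n^2 \<le> 1\<close>,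
    as chaining demands.\<close>
  define N' where "N' = max N 2"
  have "\<exists>A. A \<in> events \<and> prob A \<le> 4 * (1 / (real n)\<^sup>2) \<and> (\<forall>\<omega> t. \<omega> \<in> space M - A \<longrightarrow>
      continuous_on {u n..u n + d n} (\<lambda>t. Z t \<omega>) \<longrightarrow> t \<in> {u n..u n + d n} \<longrightarrow>
      \<bar>Z t \<omega> - Z (u n) \<omega>\<bar> \<le> 12 * sqrt (2 * ln (real n)) * sqrt (b * d n))" if n: "N' \<le> n" for n
  proof -
    have n2: "2 \<le> real n" "N \<le> n" using n by (auto simp: N'_def)
    define y where "y = sqrt (2 * ln (real n))"
    have "0 < y" using n2 by (simp add: y_def)
    have exp_y: "exp (- y\<^sup>2) = 1 / (real n)\<^sup>2"
    proof -
      have "exp (- y\<^sup>2) = inverse (exp (2 * ln (real n)))"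
        using n2 by (simp add: y_def exp_minus)
      also have "exp (2 * ln (real n)) = (real n)\<^sup>2"
        using n2 exp_of_nat_mult[of 2 "ln (real n)"] by simp
      finally show ?thesis by (simp add: inverse_eq_divide)
    qed
    have "2\<^sup>2 \<le> (real n)\<^sup>2" using n2 by (intro power_mono) auto
    then have "4 * exp (- y\<^sup>2) \<le> 1" using n2 by (simp add: exp_y field_simps)
    from chaining[OF d[of n] \<open>0 < b\<close> \<open>0 < y\<close> this Z[OF n2(2)] tail[OF n2(2)]]
    obtain A where "A \<in> events" "prob A \<le> 4 * exp (- y\<^sup>2)"
      "\<And>\<omega> t. \<omega> \<in> space M - A \<Longrightarrow> continuous_on {u n..u n + d n} (\<lambda>t. Z t \<omega>) \<Longrightarrow>
        t \<in> {u n..u n + d n} \<Longrightarrow> \<bar>Z t \<omega> - Z (u n) \<omega>\<bar> \<le> 12 * y * sqrt (b * d n)"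
      by blast
    then show ?thesis unfolding exp_y unfolding y_def by blast
  qed
  from choice[of "\<lambda>n A. N' \<le> n \<longrightarrow> A \<in> events \<and> prob A \<le> 4 * (1 / (real n)\<^sup>2) \<and> (\<forall>\<omega> t. \<omega> \<in> space M - A \<longrightarrow>
      continuous_on {u n..u n + d n} (\<lambda>t. Z t \<omega>) \<longrightarrow> t \<in> {u n..u n + d n} \<longrightarrow>
      \<bar>Z t \<omega> - Z (u n) \<omega>\<bar> \<le> 12 * sqrt (2 * ln (real n)) * sqrt (b * d n))"] this
  obtain A where A: "\<And>n. N' \<le> n \<Longrightarrow> A n \<in> events"
    and prob_A: "\<And>n. N' \<le> n \<Longrightarrow> prob (A n) \<le> 4 * (1 / (real n)\<^sup>2)"
    and osc: "\<And>n \<omega> t. N' \<le> n \<Longrightarrow> \<omega> \<in> space M - A n \<Longrightarrow>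
      continuous_on {u n..u n + d n} (\<lambda>t. Z t \<omega>) \<Longrightarrow> t \<in> {u n..u n + d n} \<Longrightarrow>
      \<bar>Z t \<omega> - Z (u n) \<omega>\<bar> \<le> 12 * sqrt (2 * ln (real n)) * sqrt (b * d n)"
    by metis
  \<comment> \<open>Below \<open>N'\<close> the chosen sets are arbitrary and perhaps not
    measurable; they are replaced by the empty set.\<close>
  define B where "B n = (if N' \<le> n then A n else {})" for n
  have "summable (\<lambda>n. 4 * (1 / (real n)\<^sup>2))"
    using inverse_power_summable[of 2, where 'a=real] by (intro summable_mult) (simp add: inverse_eq_divide)
  then have "summable (\<lambda>n. prob (B n))"
    by (rule summable_comparison_test'[of _ N']) (use prob_A in \<open>simp add: B_def\<close>)
  then have "AE \<omega> in M. \<forall>\<^sub>F n in sequentially. \<omega> \<in> space M - B n"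
    using A by (intro borel_cantelli_AE1) (auto simp: B_def emeasure_eq_measure)
  with cont show ?thesis
  proof eventually_elim
    case (elim \<omega>)
    from elim(2) eventually_ge_at_top[of N'] show ?case
    proof eventually_elim
      case (elim n)
      then show ?case
        using \<open>\<forall>n\<ge>N. continuous_on {u n..u n + d n} (\<lambda>t. Z t \<omega>)\<close>
        by (intro ballI osc) (auto simp: B_def N'_def)
    qed
  qed
qed

section \<open>The normaliser of the Wiener process on geometric grids\<close>

definition lil_scale :: "real \<Rightarrow> real" where
  "lil_scale t = sqrt (2 * t * ln (ln (1 / t)))"

lemma le_exp_iff_ln_le: "0 < t \<Longrightarrow> t \<le> exp x \<longleftrightarrow> ln t \<le> (x :: real)"
  by (metis exp_le_cancel_iff exp_ln)

text \<open>Turns a statement about all large cells into one about all small \<open>t\<close>; the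
  index is the integer part of \<open>- ln t / \<eta>\<close>.\<close>

lemma geometric_grid_index:
  assumes "0 < \<eta>" "0 < t" "t \<le> exp (- \<eta> * real N)"
  obtains n where "N \<le> n" "exp (- \<eta> * real (Suc n)) \<le> t" "t \<le> exp (- \<eta> * real n)"
proof -
  define n where "n = nat \<lfloor>- ln t / \<eta>\<rfloor>"
  have "ln t \<le> - \<eta> * real N" using assms(2,3) by (simp add: le_exp_iff_ln_le)
  then have N: "real N \<le> - ln t / \<eta>" using \<open>0 < \<eta>\<close> by (simp add: field_simps)
  have "N \<le> n" using N by (simp add: n_def le_nat_floor)
  have n: "real n = of_int \<lfloor>- ln t / \<eta>\<rfloor>"
    unfolding n_def using N by (intro of_nat_nat) simp
  have "real n \<le> - ln t / \<eta>" "- ln t / \<eta> \<le> real (Suc n)"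
    unfolding of_nat_Suc n by linarith+
  then have "ln t \<le> - \<eta> * real n" "- \<eta> * real (Suc n) \<le> ln t"
    using \<open>0 < \<eta>\<close> by (simp_all add: field_simps)
  then show thesis
    using \<open>N \<le> n\<close> by (intro that[of n]) (simp_all only: le_exp_iff_ln_le[OF \<open>0 < t\<close>] ln_ge_iff[OF \<open>0 < t\<close>])
qed

text \<open>Freezes the iterated logarithm on a cell and keeps the factor \<open>t\<close>:
  probabilistic bounds come in terms of \<open>n\<close>, the normaliser in terms of
  \<open>t\<close>.\<close>

lemma lil_scale_ge_on_grid:
  assumes "0 < \<eta>" "0 < t" "t \<le> exp (- \<eta> * real n)" "1 \<le> \<eta> * real n"
  shows "sqrt (2 * t * ln (\<eta> * real n)) \<le> lil_scale t"
proof -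
  have "ln t \<le> - \<eta> * real n" using assms(2,3) by (simp add: le_exp_iff_ln_le)
  then have "\<eta> * real n \<le> ln (1 / t)" using \<open>0 < t\<close> by (simp add: ln_div)
  then have "ln (\<eta> * real n) \<le> ln (ln (1 / t))" using assms(4) by simp
  then show ?thesis unfolding lil_scale_def using \<open>0 < t\<close> by simp
qed

text \<open>The factor \<open>1 + 2 * \<delta>\<close> is \<open>1 + \<delta>\<close> at the grid
  points plus \<delta> for the oscillation inside a cell; the factor \<open>1 + \<delta>\<close>
  pays for replacing \<open>ln n\<close> by \<open>ln (\<eta> n)\<close>.\<close>

lemma (in prob_space) wiener_upper_quadratic:
  assumes W: "wiener_process M W" and \<delta>: "0 < \<delta>"
  shows "AE \<omega> in M. \<forall>\<^sub>F t in at_right 0. W t \<omega> \<le> (1 + \<delta>) * (1 + 2 * \<delta>) * lil_scale t"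
proof -
  (* This grid ratio makes the chaining bound 12 sqrt (2 ln n) sqrt (2 (e^\<eta> - 1) t) equal to
     \<delta> sqrt (2 t ln n). *)
  define \<eta> where "\<eta> = ln (1 + \<delta>\<^sup>2 / 288)"
  have \<eta>: "0 < \<eta>" "exp \<eta> = 1 + \<delta>\<^sup>2 / 288"
    using \<delta> by (auto simp: \<eta>_def add_pos_nonneg)
  define \<tau> where "\<tau> n = exp (- \<eta> * real n)" for n
  have \<tau>: "0 < \<tau> n" "\<tau> n \<le> 1" for n
    using \<eta> by (auto simp: \<tau>_def)
  have step: "\<tau> n - \<tau> (Suc n) = \<tau> (Suc n) * (\<delta>\<^sup>2 / 288)" for n
  proof -
    have "\<tau> n = \<tau> (Suc n) * exp \<eta>" by (simp add: \<tau>_def algebra_simps flip: exp_add)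
    then show ?thesis by (simp add: \<eta> algebra_simps)
  qed
  have \<tau>_less: "\<tau> (Suc n) < \<tau> n" for n
    using \<eta> by (simp add: \<tau>_def)
  have meas: "W t \<in> borel_measurable M" if "0 \<le> t" "t \<le> 1" for t
    using W that by (auto simp: wiener_process_def)
  have "AE \<omega> in M. continuous_on {0..1} (\<lambda>t. W t \<omega>)"
    using W by (auto simp: wiener_process_def)
  then have cont: "AE \<omega> in M. \<forall>n\<ge>0. continuous_on {\<tau> (Suc n)..\<tau> (Suc n) + (\<tau> n - \<tau> (Suc n))} (\<lambda>t. W t \<omega>)"
    by (rule AE_mp) (rule AE_I2, auto intro!: continuous_on_subset[of "{0..1}"] intro: order_trans[OF less_imp_le[OF \<tau>(1)]] order_trans[OF _ \<tau>(2)])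
  \<comment> \<open>Each cell is anchored at its left end, so a bound in terms of the anchor passes
    to every larger \<open>t\<close> of the cell.\<close>
  have "AE \<omega> in M. \<forall>\<^sub>F n in sequentially. \<forall>t\<in>{\<tau> (Suc n)..\<tau> (Suc n) + (\<tau> n - \<tau> (Suc n))}.
      \<bar>W t \<omega> - W (\<tau> (Suc n)) \<omega>\<bar> \<le> 12 * sqrt (2 * ln (real n)) * sqrt (2 * (\<tau> n - \<tau> (Suc n)))"
  proof (rule eventually_oscillation_le[OF _ _ _ _ cont])
    fix n s t x assume *: "\<tau> (Suc n) \<le> s" "s < t" "t \<le> \<tau> (Suc n) + (\<tau> n - \<tau> (Suc n))" "(0::real) < x"
    show "prob {\<omega> \<in> space M. x \<le> \<bar>W t \<omega> - W s \<omega>\<bar>} \<le> 2 * exp (- x\<^sup>2 / (2 * (t - s)))"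
      using * \<tau>(1)[of "Suc n"] \<tau>(2)[of n] by (intro wiener_tail[OF W]) auto
  next
    fix n t assume "t \<in> {\<tau> (Suc n)..\<tau> (Suc n) + (\<tau> n - \<tau> (Suc n))}"
    then show "W t \<in> borel_measurable M"
      using \<tau>(1)[of "Suc n"] \<tau>(2)[of n] by (intro meas) auto
  qed (use \<tau>_less in auto)
  moreover have "AE \<omega> in M. \<forall>\<^sub>F n in sequentially.
      W (\<tau> (Suc n)) \<omega> - W 0 \<omega> < (1 + \<delta>) * sqrt (2 * \<tau> (Suc n) * ln (real n))"
  proof -
    define A where "A n = {\<omega> \<in> space M. (1 + \<delta>) * sqrt (2 * \<tau> (Suc n) * ln (real n)) \<le> W (\<tau> (Suc n)) \<omega> - W 0 \<omega>}" for n
    have [measurable]: "W 0 \<in> borel_measurable M" "W (\<tau> n) \<in> borel_measurable M" for n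
      using \<tau>[of n] by (auto intro!: meas simp: less_imp_le)
    have [measurable]: "A n \<in> events" for n
      unfolding A_def by measurable
    \<comment> \<open>The sharp tail turns the threshold into a power of \<open>n\<close> with
      exponent below -1; this is where the constant 1 of the upper half arises.\<close>
    have prob_A: "prob (A n) \<le> real n powr (- (1 + \<delta>)\<^sup>2)" if "1 \<le> n" for n
    proof -
      have "distributed M lborel (\<lambda>\<omega>. W (\<tau> (Suc n)) \<omega> - W 0 \<omega>) (normal_density 0 (sqrt (\<tau> (Suc n))))"
        using wiener_increment_normal[OF W, of 0 "\<tau> (Suc n)"] \<tau>[of "Suc n"] by simp
      from normal_tail_le[OF this, of "(1 + \<delta>) * sqrt (2 * \<tau> (Suc n) * ln (real n))"]
      have "prob (A n) \<le> exp (- ((1 + \<delta>) * sqrt (2 * \<tau> (Suc n) * ln (real n)))\<^sup>2 / (2 * (sqrt (\<tau> (Suc n)))\<^sup>2))"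
        using \<tau>(1)[of "Suc n"] \<delta> that unfolding A_def by simp
      also have "- ((1 + \<delta>) * sqrt (2 * \<tau> (Suc n) * ln (real n)))\<^sup>2 / (2 * (sqrt (\<tau> (Suc n)))\<^sup>2)
          = - (1 + \<delta>)\<^sup>2 * ln (real n)"
        using \<tau>(1)[of "Suc n"] that by (simp add: power_mult_distrib)
      finally show ?thesis
        using that by (simp add: powr_def)
    qed
    have "1 < (1 + \<delta>)\<^sup>2" using \<delta> by (simp add: one_less_power)
    then have "summable (\<lambda>n. real n powr (- (1 + \<delta>)\<^sup>2))"
      by (subst summable_real_powr_iff) simp
    then have "summable (\<lambda>n. prob (A n))"
      by (rule summable_comparison_test'[of _ 1]) (use prob_A in simp)
    then have "AE \<omega> in M. \<forall>\<^sub>F n in sequentially. \<omega> \<in> space M - A n"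
      by (intro borel_cantelli_AE1) (auto simp: emeasure_eq_measure)
    then show ?thesis
      by (rule AE_mp) (rule AE_I2, auto simp: A_def not_le elim!: eventually_mono)
  qed
  moreover have "AE \<omega> in M. W 0 \<omega> = 0"
    using W by (auto simp: wiener_process_def)
  ultimately show ?thesis
  proof eventually_elim
    case (elim \<omega>)
    have "\<forall>\<^sub>F n in sequentially. ln (real n) \<le> (1 + \<delta>)\<^sup>2 * ln (\<eta> * real n)"
    proof -
      \<comment> \<open>The grid ratio shifts the logarithm by the constant \<open>ln \<eta>\<close>
        only, which disappears in the quotient.\<close>
      have "((\<lambda>n. ln (real n) / ln (\<eta> * real n)) \<longlongrightarrow> 1) sequentially"
        using \<open>0 < \<eta>\<close> by real_asymp
      moreover have "1 < (1 + \<delta>)\<^sup>2" using \<delta> by (simp add: one_less_power)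
      ultimately have "\<forall>\<^sub>F n in sequentially. ln (real n) / ln (\<eta> * real n) < (1 + \<delta>)\<^sup>2"
        by (rule order_tendstoD(2))
      moreover have "\<forall>\<^sub>F n in sequentially. 0 < ln (\<eta> * real n)"
        using \<open>0 < \<eta>\<close> by real_asymp
      ultimately show ?thesis
        by eventually_elim (simp add: field_simps)
    qed
    moreover have "\<forall>\<^sub>F n in sequentially. 1 \<le> \<eta> * real n"
      using \<open>0 < \<eta>\<close> by real_asymp
    ultimately have "\<forall>\<^sub>F n in sequentially. \<forall>t\<in>{\<tau> (Suc n)..\<tau> n}. W t \<omega> \<le> (1 + \<delta>) * (1 + 2 * \<delta>) * lil_scale t"
      using elim(1,2) eventually_ge_at_top[of 1]
    proof eventually_elim
      case (elim n)
      show ?case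
      proof
        fix t assume t: "t \<in> {\<tau> (Suc n)..\<tau> n}"
        have "0 < t" using t \<tau>(1)[of "Suc n"] by simp
        define r where "r = sqrt (2 * \<tau> (Suc n) * ln (real n))"
        have "12 * sqrt (2 * ln (real n)) * sqrt (2 * (\<tau> n - \<tau> (Suc n)))
            = 12 * sqrt (2 * ln (real n) * (2 * (\<tau> (Suc n) * (\<delta>\<^sup>2 / 288))))"
          unfolding step by (simp only: real_sqrt_mult mult.assoc)
        also have "2 * ln (real n) * (2 * (\<tau> (Suc n) * (\<delta>\<^sup>2 / 288))) = (\<delta> / 12)\<^sup>2 * (2 * \<tau> (Suc n) * ln (real n))"
          by (simp add: power_divide)
        also have "12 * sqrt \<dots> = \<delta> * r"
          using \<delta> by (simp add: r_def real_sqrt_mult)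
        finally have osc: "12 * sqrt (2 * ln (real n)) * sqrt (2 * (\<tau> n - \<tau> (Suc n))) = \<delta> * r" .
        have "\<bar>W t \<omega> - W (\<tau> (Suc n)) \<omega>\<bar> \<le> \<delta> * r"
          using elim t unfolding osc by simp
        moreover have "W (\<tau> (Suc n)) \<omega> \<le> (1 + \<delta>) * r"
          using elim \<open>W 0 \<omega> = 0\<close> by (simp add: r_def)
        ultimately have W_le: "W t \<omega> \<le> (1 + 2 * \<delta>) * r"
          by (simp add: algebra_simps)
        have "r \<le> sqrt (2 * t * ((1 + \<delta>)\<^sup>2 * ln (\<eta> * real n)))"
          unfolding r_def using t \<open>0 < t\<close> elim less_imp_le[OF \<tau>(1)[of "Suc n"]] by (intro real_sqrt_le_mono mult_mono) auto
        also have "\<dots> = (1 + \<delta>) * sqrt (2 * t * ln (\<eta> * real n))"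
          using \<delta> by (simp add: real_sqrt_mult)
        also have "\<dots> \<le> (1 + \<delta>) * lil_scale t"
          using t \<open>0 < t\<close> \<open>0 < \<eta>\<close> elim \<delta> by (intro mult_left_mono lil_scale_ge_on_grid) (auto simp: \<tau>_def)
        finally have "(1 + 2 * \<delta>) * r \<le> (1 + 2 * \<delta>) * ((1 + \<delta>) * lil_scale t)"
          using \<delta> by (intro mult_left_mono) auto
        then show "W t \<omega> \<le> (1 + \<delta>) * (1 + 2 * \<delta>) * lil_scale t"
          using W_le by (simp add: mult_ac)
      qed
    qed
    then obtain N where N: "\<And>n t. N \<le> n \<Longrightarrow> t \<in> {\<tau> (Suc n)..\<tau> n} \<Longrightarrow>
        W t \<omega> \<le> (1 + \<delta>) * (1 + 2 * \<delta>) * lil_scale t"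
      unfolding eventually_sequentially by blast
    have "\<forall>\<^sub>F t in at_right 0. t \<in> {0<..<\<tau> N}"
      using \<tau>(1)[of N] by (rule eventually_at_right_real)
    then show ?case
    proof eventually_elim
      case (elim t)
      then have "0 < t" "t \<le> exp (- \<eta> * real N)" by (auto simp: \<tau>_def)
      from geometric_grid_index[OF \<open>0 < \<eta>\<close> this] obtain n where
        "N \<le> n" "exp (- \<eta> * real (Suc n)) \<le> t" "t \<le> exp (- \<eta> * real n)" .
      then show ?case
        by (intro N[of n]) (auto simp only: \<tau>_def atLeastAtMost_iff)
    qed
  qed
qed

text \<open>Strictly between \<open>exp (-1)\<close> and 1 the double logarithm is negative and,
  \<open>sqrt\<close> being odd, so is the scale; hence the restriction.\<close>

lemma lil_scale_nonneg: "0 < t \<Longrightarrow> t \<le> exp (-1) \<Longrightarrow> 0 \<le> lil_scale t"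
  using lil_scale_ge_on_grid[of 1 t 1] by (simp add: order_trans[of 0 "sqrt _"])

lemma (in prob_space) wiener_upper:
  assumes W: "wiener_process M W" and "0 < \<epsilon>"
  shows "AE \<omega> in M. \<forall>\<^sub>F t in at_right 0. W t \<omega> \<le> (1 + \<epsilon>) * lil_scale t"
proof -
  \<comment> \<open>For \<open>\<delta> \<le> 1\<close> the product
    \<open>(1 + \<delta>) * (1 + 2 * \<delta>)\<close> is at most
    \<open>1 + 5 * \<delta>\<close>.\<close>
  define \<delta> where "\<delta> = min 1 (\<epsilon> / 5)"
  have \<delta>: "0 < \<delta>" "\<delta> \<le> 1" "\<delta> \<le> \<epsilon> / 5" using \<open>0 < \<epsilon>\<close> by (auto simp: \<delta>_def)
  have "\<delta> * \<delta> \<le> \<delta> * 1" using \<delta> by (intro mult_left_mono) auto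
  moreover have "(1 + \<delta>) * (1 + 2 * \<delta>) = 1 + 3 * \<delta> + 2 * (\<delta> * \<delta>)" by (simp add: algebra_simps)
  ultimately have *: "(1 + \<delta>) * (1 + 2 * \<delta>) \<le> 1 + \<epsilon>" using \<delta> by linarith
  have pos: "\<forall>\<^sub>F t in at_right 0. 0 \<le> lil_scale t"
    using eventually_at_right_real[of 0 "exp (-1)"]
    by (auto elim!: eventually_mono intro!: lil_scale_nonneg)
  from wiener_upper_quadratic[OF W \<delta>(1)] show ?thesis
  proof eventually_elim
    case (elim \<omega>)
    from elim pos show ?case
    proof eventually_elim
      case (elim t)
      then show ?case using mult_right_mono[OF *, of "lil_scale t"] by simp
    qed
  qed
qed

text \<open>On a grid of ratio \<open>\<kappa>^2\<close> the increment \<open>X n\<close> carries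
  the fraction \<open>c = sqrt (1 - \<kappa>^2)\<close> of the standard deviation of
  \<open>W (\<tau> n)\<close>. The increments are independent and large infinitely often, while the
  value they start from costs only the fraction \<open>2 * \<kappa>\<close> of the scale.\<close>

lemma (in prob_space) wiener_lower:
  assumes W: "wiener_process M W" and "0 < \<epsilon>"
  shows "AE \<omega> in M. \<exists>\<^sub>F t in at_right 0. (1 - \<epsilon>) * lil_scale t \<le> W t \<omega>"
proof -
  \<comment> \<open>Since \<open>1 - \<kappa> \<le> c\<close>, the total loss is at most
    \<open>3 * \<kappa>\<close>, well below \<epsilon>.\<close>
  define \<kappa> where "\<kappa> = min (1 / 2) (\<epsilon> / 8)"
  have \<kappa>: "0 < \<kappa>" "\<kappa> < 1" "\<kappa> \<le> \<epsilon> / 8" using \<open>0 < \<epsilon>\<close> by (auto simp: \<kappa>_def)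
  define \<eta> where "\<eta> = - 2 * ln \<kappa>"
  have \<eta>: "0 < \<eta>" using \<kappa> by (simp add: \<eta>_def)
  define \<tau> where "\<tau> n = exp (- \<eta> * real n)" for n
  have \<tau>: "0 < \<tau> n" "\<tau> n \<le> 1" for n
    using \<eta> by (auto simp: \<tau>_def)
  have "exp (- \<eta>) = \<kappa>\<^sup>2"
  proof -
    have "exp (- \<eta>) = exp (ln \<kappa> + ln \<kappa>)" by (simp add: \<eta>_def)
    then show ?thesis using \<kappa> by (simp only: exp_add exp_ln power2_eq_square)
  qed
  then have step: "\<tau> (Suc n) = \<kappa>\<^sup>2 * \<tau> n" for n
    by (simp add: \<tau>_def algebra_simps exp_add exp_diff exp_minus field_simps)
  have \<kappa>2: "\<kappa>\<^sup>2 \<le> \<kappa>" using \<kappa> by (simp add: power2_eq_square)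
  have \<tau>_less: "\<tau> (Suc n) < \<tau> n" for n
    using \<tau>(1)[of n] \<kappa>2 \<kappa> by (simp add: step)
  define c where "c = sqrt (1 - \<kappa>\<^sup>2)"
  have "1 - \<kappa> \<le> c"
  proof -
    have "(1 - \<kappa>)\<^sup>2 \<le> (1 - \<kappa>) * 1" unfolding power2_eq_square using \<kappa> by (intro mult_left_mono) auto
    then have "(1 - \<kappa>)\<^sup>2 \<le> 1 - \<kappa>\<^sup>2" using \<kappa>2 by simp
    then show ?thesis unfolding c_def by (rule real_le_rsqrt)
  qed
  then have c: "1 - \<epsilon> < c - 2 * \<kappa>" using \<kappa> \<open>0 < \<epsilon>\<close> by linarith
  define X where "X n \<omega> = W (\<tau> n) \<omega> - W (\<tau> (Suc n)) \<omega>" for n \<omega>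
  (* With this threshold the tail bound is exactly a multiple of 1/n, so no slack in the exponent is needed. *)
  define x where "x n = sqrt (\<tau> n - \<tau> (Suc n)) * (sqrt (2 * ln (real n)) - 1)" for n
  have indep: "indep_vars (\<lambda>_. borel) X UNIV"
    unfolding X_def[abs_def] using \<tau> \<tau>_less
    by (intro wiener_decreasing_increments_indep[OF W]) (auto intro!: decseq_SucI simp: less_imp_le)
  have prob_ge: "1 / sqrt (2 * pi) * (1 / real n) \<le> prob (X n -` {x n..} \<inter> space M)" if "2 \<le> n" for n
  proof -
    have D: "distributed M lborel (X n) (normal_density 0 (sqrt (\<tau> n - \<tau> (Suc n))))"
      unfolding X_def[abs_def] using \<tau>(1)[of "Suc n"] \<tau>(2)[of n] \<tau>_less[of n]
      by (intro wiener_increment_normal[OF W]) auto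
    \<comment> \<open>Ensures \<open>sqrt (2 ln n) - 1 \<ge> 0\<close>, the sign condition of the
      lower tail bound, from \<open>n = 2\<close> on.\<close>
    have "1 / 2 \<le> ln (2 :: real)"
      using exp_bound_half[of "1 / 2 :: real"] ln_ge_iff[of 2 "1 / 2 :: real"] by simp
    moreover have "ln 2 \<le> ln (real n)" using that by simp
    ultimately have "1 / 2 \<le> ln (real n)" by linarith
    then have "1 \<le> sqrt (2 * ln (real n))" by simp
    then have "exp (- (sqrt (2 * ln (real n)))\<^sup>2 / 2) / sqrt (2 * pi) \<le> prob {\<omega> \<in> space M. x n \<le> X n \<omega>}"
      using normal_tail_ge[OF D, of "sqrt (2 * ln (real n)) - 1"] \<tau>_less[of n] by (simp add: x_def)
    also have "{\<omega> \<in> space M. x n \<le> X n \<omega>} = X n -` {x n..} \<inter> space M" by auto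
    also have "exp (- (sqrt (2 * ln (real n)))\<^sup>2 / 2) = 1 / real n"
      using that by (simp add: exp_minus inverse_eq_divide)
    finally show ?thesis by (simp add: mult.commute)
  qed
  have "\<not> summable (\<lambda>n. prob (X n -` {x n..} \<inter> space M))"
  proof
    assume "summable (\<lambda>n. prob (X n -` {x n..} \<inter> space M))"
    then have "summable (\<lambda>n. 1 / sqrt (2 * pi) * (1 / real n))"
      by (rule summable_comparison_test'[of _ 2]) (use prob_ge in simp)
    then have "summable (\<lambda>n. 1 / real n)"
      by (subst (asm) summable_cmult_iff) auto
    then show False
      using not_summable_harmonic[where 'a=real] by (simp add: inverse_eq_divide)
  qed
  from borel_cantelli_indep_vars[OF indep _ this]
  have "AE \<omega> in M. \<exists>\<^sub>F n in sequentially. X n \<omega> \<in> {x n..}" by simp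
  \<comment> \<open>A crude constant 2 is enough here, because the scale at the next grid point is
    smaller by a factor close to \<kappa>.\<close>
  moreover have "AE \<omega> in M. \<forall>\<^sub>F t in at_right 0. - W t \<omega> \<le> (1 + 1) * lil_scale t"
    by (intro wiener_upper wiener_process_uminus W) simp
  ultimately show ?thesis
  proof eventually_elim
    case (elim \<omega>)
    have lim: "filterlim \<tau> (at_right 0) sequentially"
      unfolding \<tau>_def using \<eta> by real_asymp
    have lim_Suc: "filterlim (\<lambda>n. \<tau> (Suc n)) (at_right 0) sequentially"
      by (rule filterlim_compose[OF lim filterlim_Suc])
    have lower: "\<forall>\<^sub>F n in sequentially. - W (\<tau> (Suc n)) \<omega> \<le> (1 + 1) * lil_scale (\<tau> (Suc n))"
      using filterlim_iff[THEN iffD1, OF lim_Suc] elim(2) by blast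
    have scale: "lil_scale (\<tau> n) = sqrt (\<tau> n) * sqrt (2 * ln (\<eta> * real n))" for n
    proof -
      have "ln (1 / \<tau> n) = - ln (\<tau> n)" using \<tau>(1)[of n] by (simp add: ln_div)
      also have "\<dots> = \<eta> * real n" by (simp add: \<tau>_def)
      finally show ?thesis unfolding lil_scale_def by (simp add: real_sqrt_mult)
    qed
    have "\<forall>\<^sub>F n in sequentially. (1 - \<epsilon>) * lil_scale (\<tau> n) \<le> x n - 2 * lil_scale (\<tau> (Suc n))"
    proof -
      have "((\<lambda>n. (sqrt (2 * ln (real n)) - 1) / sqrt (2 * ln (\<eta> * real n))) \<longlongrightarrow> 1) sequentially"
        using \<eta> by real_asymp
      moreover have "((\<lambda>n. sqrt (2 * ln (\<eta> * real (Suc n))) / sqrt (2 * ln (\<eta> * real n))) \<longlongrightarrow> 1) sequentially"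
        using \<eta> by real_asymp
      ultimately have "((\<lambda>n. c * ((sqrt (2 * ln (real n)) - 1) / sqrt (2 * ln (\<eta> * real n)))
          - 2 * \<kappa> * (sqrt (2 * ln (\<eta> * real (Suc n))) / sqrt (2 * ln (\<eta> * real n)))) \<longlongrightarrow> c * 1 - 2 * \<kappa> * 1) sequentially"
        by (intro tendsto_intros)
      from order_tendstoD(1)[OF this, of "1 - \<epsilon>"] c
      have "\<forall>\<^sub>F n in sequentially. 1 - \<epsilon> < c * ((sqrt (2 * ln (real n)) - 1) / sqrt (2 * ln (\<eta> * real n)))
          - 2 * \<kappa> * (sqrt (2 * ln (\<eta> * real (Suc n))) / sqrt (2 * ln (\<eta> * real n)))"
        by simp
      moreover have "\<forall>\<^sub>F n in sequentially. 0 < sqrt (2 * ln (\<eta> * real n))"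
        using \<eta> by real_asymp
      ultimately show ?thesis
      proof eventually_elim
        case (elim n)
        define s where "s = sqrt (2 * ln (\<eta> * real n))"
        have "0 < s" using elim by (simp add: s_def)
        have "(1 - \<epsilon>) * s \<le> (c * ((sqrt (2 * ln (real n)) - 1) / s)
            - 2 * \<kappa> * (sqrt (2 * ln (\<eta> * real (Suc n))) / s)) * s"
          using elim \<open>0 < s\<close> by (intro mult_right_mono) (simp_all add: s_def)
        also have "\<dots> = c * (sqrt (2 * ln (real n)) - 1) - 2 * \<kappa> * sqrt (2 * ln (\<eta> * real (Suc n)))"
          using \<open>0 < s\<close> by (simp add: left_diff_distrib)
        finally have "sqrt (\<tau> n) * ((1 - \<epsilon>) * s)
            \<le> sqrt (\<tau> n) * (c * (sqrt (2 * ln (real n)) - 1) - 2 * \<kappa> * sqrt (2 * ln (\<eta> * real (Suc n))))"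
          using \<tau>(1)[of n] by (intro mult_left_mono) (auto simp: less_imp_le)
        moreover have "sqrt (\<tau> n - \<tau> (Suc n)) = sqrt (\<tau> n) * c"
          by (simp add: step c_def right_diff_distrib mult.commute flip: real_sqrt_mult)
        moreover have "sqrt (\<tau> (Suc n)) = \<kappa> * sqrt (\<tau> n)"
          using \<kappa> by (simp add: step real_sqrt_mult)
        ultimately show ?case
          unfolding scale x_def s_def by (simp add: algebra_simps)
      qed
    qed
    with lower have "\<forall>\<^sub>F n in sequentially. X n \<omega> \<in> {x n..} \<longrightarrow> (1 - \<epsilon>) * lil_scale (\<tau> n) \<le> W (\<tau> n) \<omega>"
      by eventually_elim (simp add: X_def)
    with elim(1) have "\<exists>\<^sub>F n in sequentially. (1 - \<epsilon>) * lil_scale (\<tau> n) \<le> W (\<tau> n) \<omega>"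
      by (rule frequently_rev_mp)
    \<comment> \<open>Since \<open>\<tau> n\<close> tends to 0 from the right, infinitely many good
      \<open>n\<close> give good \<open>t\<close> arbitrarily close to 0.\<close>
    then show ?case
      using lim unfolding frequently_def filterlim_iff by blast
  qed
qed

section \<open>The Volterra process near the origin\<close>

lemma Limsup_ereal_eq_1:
  fixes f :: "'b \<Rightarrow> real"
  assumes upper: "\<And>y. 1 < y \<Longrightarrow> \<forall>\<^sub>F t in F. f t \<le> y"
    and lower: "\<And>y. y < 1 \<Longrightarrow> \<exists>\<^sub>F t in F. y \<le> f t"
  shows "Limsup F (\<lambda>t. ereal (f t)) = 1"
proof (rule antisym)
  show "Limsup F (\<lambda>t. ereal (f t)) \<le> 1"
  proof (rule ereal_le_epsilon2)
    fix e :: real assume "0 < e"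
    show "Limsup F (\<lambda>t. ereal (f t)) \<le> 1 + ereal e"
      using upper[of "1 + e"] \<open>0 < e\<close> by (intro Limsup_bounded) (simp add: one_ereal_def)
  qed
  show "1 \<le> Limsup F (\<lambda>t. ereal (f t))"
  proof (rule ccontr)
    assume "\<not> ?thesis"
    then obtain z where z: "Limsup F (\<lambda>t. ereal (f t)) < z" "z < 1"
      using dense not_le by metis
    \<comment> \<open>The separating value \<open>z\<close> is an extended real and may be minus
      infinity; a real \<open>y\<close> below 1 is put above it.\<close>
    have "\<exists>y<1. z \<le> ereal y"
    proof (cases z)
      case (real r) then show ?thesis using z(2) by (auto simp: one_ereal_def)
    next
      case MInf then show ?thesis by (intro exI[of _ 0]) auto
    qed (use z(2) in auto)
    then obtain y where y: "y < 1" "z \<le> ereal y" by blast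
    from Limsup_lessD[OF z(1)] have "\<forall>\<^sub>F t in F. \<not> y \<le> f t"
    proof eventually_elim
      case (elim t)
      then have "ereal (f t) < ereal y" using y(2) by (rule order.strict_trans2)
      then show ?case by simp
    qed
    then show False using lower[OF y(1)] by (simp add: frequently_def)
  qed
qed

lemma wiener_approx_cong_AE:
  assumes "wiener_approx M W f Z" "AE \<omega> in M. Z \<omega> = V \<omega>" "V \<in> borel_measurable M"
  shows "wiener_approx M W f V"
proof -
  have "(\<integral>\<^sup>+\<omega>. ennreal ((V \<omega> - S \<omega>)\<^sup>2) \<partial>M) = (\<integral>\<^sup>+\<omega>. ennreal ((Z \<omega> - S \<omega>)\<^sup>2) \<partial>M)" for S
    using assms(2) by (intro nn_integral_cong_AE) (auto elim!: AE_mp)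
  then show ?thesis using assms(1,3) by (simp add: wiener_approx_def)
qed

(* The kernel of the Gaussian process X - K(0,0) W. *)
definition kernel_deviation :: "(real \<Rightarrow> real \<Rightarrow> real) \<Rightarrow> real \<Rightarrow> real \<Rightarrow> real" where
  "kernel_deviation K t s = K t s * indicator {0..t} s - K 0 0 * indicator {0<..t} s"

lemma kernel_deviation_increment:
  fixes K :: "real \<Rightarrow> real \<Rightarrow> real"
  assumes cont: "continuous_on ({0..1} \<times> {0..1}) (\<lambda>(t, s). K t s)"
    and diff: "continuously_differentiable_fst K" and "0 < \<epsilon>"
  obtains \<delta> where "0 < \<delta>" "\<delta> \<le> 1"
    and "\<And>u t. 0 \<le> u \<Longrightarrow> u < t \<Longrightarrow> t \<le> \<delta> \<Longrightarrow>
      (\<integral>\<^sup>+s. ennreal ((kernel_deviation K t s - kernel_deviation K u s)\<^sup>2) \<partial>lborel) \<le> ennreal (\<epsilon> * (t - u))"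
proof -
  obtain K' where K': "\<And>t s. t \<in> {0..1} \<Longrightarrow> s \<in> {0..1} \<Longrightarrow>
      ((\<lambda>u. K u s) has_real_derivative K' t s) (at t within {0..1})"
    and K'_cont: "continuous_on ({0..1} \<times> {0..1}) (\<lambda>(t, s). K' t s)"
    using diff unfolding continuously_differentiable_fst_def by blast
  have "bounded ((\<lambda>(t, s). K' t s) ` ({0..1} \<times> {0..1}))"
    by (intro compact_imp_bounded compact_continuous_image K'_cont compact_Times compact_Icc)
  then obtain L where L: "0 < L" "\<And>t s. t \<in> {0..1} \<Longrightarrow> s \<in> {0..1} \<Longrightarrow> \<bar>K' t s\<bar> \<le> L"
    unfolding bounded_pos by force
  have lipschitz: "\<bar>K t s - K u s\<bar> \<le> L * \<bar>t - u\<bar>"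
    if "t \<in> {0..1}" "u \<in> {0..1}" "s \<in> {0..1}" for t u s
    using field_differentiable_bound[of "{0..1}" "\<lambda>u. K u s" "\<lambda>t. K' t s" L u t] K' L that
    by (simp add: abs_minus_commute)
  define e where "e = sqrt (\<epsilon> / 2)"
  have e: "0 < e" "e\<^sup>2 = \<epsilon> / 2" using \<open>0 < \<epsilon>\<close> by (auto simp: e_def)
  obtain d where d: "0 < d" "\<And>t s. t \<in> {0..1} \<Longrightarrow> s \<in> {0..1} \<Longrightarrow> dist (t, s) (0, 0) < d \<Longrightarrow> \<bar>K t s - K 0 0\<bar> < e"
    using cont[unfolded continuous_on_iff, rule_format, of "(0, 0)" e] e(1)
    by (auto simp: dist_real_def)
  \<comment> \<open>The bound \<open>d / 3\<close> keeps \<open>(t, s)\<close> within distance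
    \<open>d\<close> of the origin, and \<open>e / L\<close> makes both \<open>L (t - u)\<close> and
    \<open>L u\<close> at most \<open>e\<close>. Each of the two parts then contributes
    \<open>e^2 (t - u)\<close>, half of the allowance.\<close>
  define \<delta> where "\<delta> = min 1 (min (d / 3) (e / L))"
  have "0 < \<delta>" using \<open>0 < d\<close> e L by (auto simp: \<delta>_def)
  moreover have "\<delta> \<le> 1" "\<delta> \<le> d / 3" "\<delta> \<le> e / L"
    unfolding \<delta>_def by (meson min.cobounded1 min.cobounded2 order_trans)+
  ultimately have \<delta>: "0 < \<delta>" "\<delta> \<le> 1" "\<delta> \<le> d / 3" "\<delta> \<le> e / L" .
  have "L * \<delta> \<le> e" using \<delta>(4) L by (simp add: field_simps)
  have near: "\<bar>K t s - K 0 0\<bar> \<le> e" if "t \<in> {0..\<delta>}" "s \<in> {0..\<delta>}" for t s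
  proof -
    have "dist (t, s) (0, 0) \<le> \<bar>t\<bar> + \<bar>s\<bar>"
      unfolding dist_Pair_Pair dist_real_def using sqrt_sum_squares_le_sum_abs[of t s] by simp
    also have "\<dots> < d" using that \<delta> \<open>0 < d\<close> by auto
    finally show ?thesis using d(2)[of t s] that \<delta> by auto
  qed
  show thesis
  proof (rule that[OF \<delta>(1,2)])
    fix u t assume ut: "0 \<le> u" "u < t" "t \<le> \<delta>"
    have pointwise: "(kernel_deviation K t s - kernel_deviation K u s)\<^sup>2
        \<le> (L * (t - u))\<^sup>2 * indicator {0..u} s + e\<^sup>2 * indicator {u<..t} s" for s
    proof -
      consider "s \<in> {0..u}" | "s \<in> {u<..t}" | "s \<notin> {0..t}" using ut by force
      then show ?thesis
      proof cases
        case 1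
        then have "\<bar>K t s - K u s\<bar> \<le> L * (t - u)"
          using lipschitz[of t u s] ut \<delta> by auto
        then have "(K t s - K u s)\<^sup>2 \<le> (L * (t - u))\<^sup>2"
          using power_mono[of "\<bar>K t s - K u s\<bar>" _ 2] by simp
        then show ?thesis
          using 1 ut by (auto simp: kernel_deviation_def indicator_def)
      next
        case 2
        then have "\<bar>K t s - K 0 0\<bar> \<le> e" using near[of t s] ut by auto
        then have "(K t s - K 0 0)\<^sup>2 \<le> e\<^sup>2"
          using power_mono[of "\<bar>K t s - K 0 0\<bar>" _ 2] by simp
        then show ?thesis
          using 2 ut by (auto simp: kernel_deviation_def indicator_def)
      next
        case 3
        then show ?thesis using ut by (auto simp: kernel_deviation_def indicator_def)
      qed
    qed
    have "(\<integral>\<^sup>+s. ennreal ((kernel_deviation K t s - kernel_deviation K u s)\<^sup>2) \<partial>lborel)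
        \<le> (\<integral>\<^sup>+s. ennreal ((L * (t - u))\<^sup>2) * indicator {0..u} s + ennreal (e\<^sup>2) * indicator {u<..t} s \<partial>lborel)"
    proof (rule nn_integral_mono)
      fix s
      have "ennreal ((kernel_deviation K t s - kernel_deviation K u s)\<^sup>2)
          \<le> ennreal ((L * (t - u))\<^sup>2 * indicator {0..u} s + e\<^sup>2 * indicator {u<..t} s)"
        by (rule ennreal_leI[OF pointwise])
      also have "\<dots> = ennreal ((L * (t - u))\<^sup>2) * indicator {0..u} s + ennreal (e\<^sup>2) * indicator {u<..t} s"
        by (auto simp: indicator_def)
      finally show "ennreal ((kernel_deviation K t s - kernel_deviation K u s)\<^sup>2)
          \<le> ennreal ((L * (t - u))\<^sup>2) * indicator {0..u} s + ennreal (e\<^sup>2) * indicator {u<..t} s" .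
    qed
    also have "\<dots> = ennreal ((L * (t - u))\<^sup>2) * ennreal u + ennreal (e\<^sup>2) * ennreal (t - u)"
      using ut by (subst nn_integral_add) (auto simp: nn_integral_cmult_indicator)
    also have "\<dots> = ennreal ((L * (t - u))\<^sup>2 * u + e\<^sup>2 * (t - u))"
      using ut by (simp add: ennreal_mult ennreal_plus)
    also have "\<dots> \<le> ennreal (\<epsilon> * (t - u))"
    proof (rule ennreal_leI)
      have "L * (t - u) \<le> L * \<delta>" using L ut by (intro mult_left_mono) auto
      then have 1: "L * (t - u) \<le> e" using \<open>L * \<delta> \<le> e\<close> by linarith
      have "L * u \<le> L * \<delta>" using L ut by (intro mult_left_mono) auto
      then have 2: "L * u \<le> e" using \<open>L * \<delta> \<le> e\<close> by linarith
      have "(L * (t - u)) * (L * u) \<le> e * e"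
        using 1 2 L ut e by (intro mult_mono) auto
      then have "(t - u) * ((L * (t - u)) * (L * u)) \<le> (t - u) * (e * e)"
        using ut by (intro mult_left_mono) auto
      then have "(L * (t - u))\<^sup>2 * u + e\<^sup>2 * (t - u) \<le> 2 * e\<^sup>2 * (t - u)"
        by (simp add: power2_eq_square algebra_simps)
      then show "(L * (t - u))\<^sup>2 * u + e\<^sup>2 * (t - u) \<le> \<epsilon> * (t - u)" by (simp add: e)
    qed
    finally show "(\<integral>\<^sup>+s. ennreal ((kernel_deviation K t s - kernel_deviation K u s)\<^sup>2) \<partial>lborel) \<le> ennreal (\<epsilon> * (t - u))" .
  qed
qed

lemma kernel_deviation_approx:
  assumes W: "wiener_process M W" and Y: "volterra_process M W K Y"
    and X: "continuous_modification M {0..1} Y X" and t: "t \<in> {0..1}"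
  shows "wiener_approx M W (kernel_deviation K t) (\<lambda>\<omega>. X t \<omega> - K 0 0 * (W t \<omega> - W 0 \<omega>))"
proof -
  have "wiener_approx M W (\<lambda>s. K t s * indicator {0..t} s) (Y t)"
    using Y t by (intro wiener_approx_wiener_integral) (auto simp: volterra_process_def)
  moreover have "AE \<omega> in M. X t \<omega> = Y t \<omega>" and X_meas: "X t \<in> borel_measurable M"
    using X t by (simp_all add: continuous_modification_def)
  then have "AE \<omega> in M. Y t \<omega> = X t \<omega>" by (auto elim!: eventually_mono)
  note this X_meas
  ultimately have "wiener_approx M W (\<lambda>s. K t s * indicator {0..t} s) (X t)"
    by (rule wiener_approx_cong_AE)
  then show ?thesis
    using t unfolding kernel_deviation_def[abs_def]
    by (intro wiener_approx_diff wiener_approx_increment W) auto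
qed

section \<open>Remainder, variance and the law for the Volterra process\<close>

locale volterra =
  fixes M :: "'a measure" and W X Y :: "real \<Rightarrow> 'a \<Rightarrow> real" and K :: "real \<Rightarrow> real \<Rightarrow> real"
  assumes K_cont: "continuous_on ({0..1} \<times> {0..1}) (\<lambda>(t, s). K t s)"
    and K_diff: "continuously_differentiable_fst K"
    and K_nz: "K 0 0 \<noteq> 0"
    and W: "wiener_process M W"
    and Y: "volterra_process M W K Y"
    and X: "continuous_modification M {0..1} Y X"
begin

sublocale prob_space M
  using W by (simp add: wiener_process_def)

text \<open>The increment \<open>W t - W 0\<close> appears because \<open>W 0\<close> vanishes only
  almost surely, and increments are what the Wiener integral of a step function consists of.\<close>

definition remainder :: "real \<Rightarrow> 'a \<Rightarrow> real" where
  "remainder t \<omega> = X t \<omega> - K 0 0 * (W t \<omega> - W 0 \<omega>)"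

lemma measurable_W: "t \<in> {0..1} \<Longrightarrow> W t \<in> borel_measurable M"
  using W by (simp add: wiener_process_def)

lemma measurable_X: "t \<in> {0..1} \<Longrightarrow> X t \<in> borel_measurable M"
  using X by (simp add: continuous_modification_def)

lemma measurable_remainder: "t \<in> {0..1} \<Longrightarrow> remainder t \<in> borel_measurable M"
  unfolding remainder_def[abs_def]
  by (intro borel_measurable_diff borel_measurable_times borel_measurable_const measurable_W measurable_X) auto

lemma remainder_approx: "t \<in> {0..1} \<Longrightarrow> wiener_approx M W (kernel_deviation K t) (remainder t)"
  unfolding remainder_def[abs_def] by (rule kernel_deviation_approx[OF W Y X])

lemma remainder_increment_approx:
  assumes "u \<in> {0..1}" "t \<in> {0..1}"
  shows "wiener_approx M W (\<lambda>s. kernel_deviation K t s - kernel_deviation K u s) (\<lambda>\<omega>. remainder t \<omega> - remainder u \<omega>)"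
  using assms by (intro wiener_approx_diff W remainder_approx)

text \<open>At time 0 the kernel lives on the single point \<open>s = 0\<close>, so its norm
  vanishes. The moment bound asks for a positive \<open>v\<close> and is therefore applied with
  arbitrarily small ones.\<close>

lemma remainder_0: "AE \<omega> in M. remainder 0 \<omega> = 0"
proof -
  have "(\<integral>\<^sup>+s. ennreal ((kernel_deviation K 0 s)\<^sup>2) \<partial>lborel) = (\<integral>\<^sup>+s. 0 \<partial>(lborel :: real measure))"
    using AE_lborel_singleton[of "0 :: real"]
    by (intro nn_integral_cong_AE) (auto elim!: eventually_mono simp: kernel_deviation_def indicator_def)
  then have small: "(\<integral>\<^sup>+s. ennreal ((kernel_deviation K 0 s)\<^sup>2) \<partial>lborel) = 0" by simp
  have "(\<integral>\<^sup>+\<omega>. ennreal ((remainder 0 \<omega>)\<^sup>2) \<partial>M) \<le> 0"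
  proof (rule ennreal_le_epsilon)
    fix e :: real assume "0 < e"
    then show "(\<integral>\<^sup>+\<omega>. ennreal ((remainder 0 \<omega>)\<^sup>2) \<partial>M) \<le> 0 + ennreal e"
      using wiener_approx_second_moment[OF W remainder_approx[of 0], of "e / 8"] small by simp
  qed
  then have "(\<integral>\<^sup>+\<omega>. ennreal ((remainder 0 \<omega>)\<^sup>2) \<partial>M) = 0" by simp
  then have "AE \<omega> in M. ennreal ((remainder 0 \<omega>)\<^sup>2) = 0"
    using measurable_remainder[of 0] by (subst (asm) nn_integral_0_iff_AE) auto
  then show ?thesis by (rule AE_mp) simp
qed

text \<open>Chaining from the origin over \<open>[0, exp (- n)]\<close> bounds the remainder by a
  multiple of \<open>sqrt (\<epsilon> exp (- n) ln n)\<close>. For \<open>t\<close> in the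
  \<open>n\<close>-th cell this is \<open>sqrt \<epsilon>\<close> times the scale, up to a
  constant.\<close>

lemma remainder_negligible:
  assumes "0 < \<rho>"
  shows "AE \<omega> in M. \<forall>\<^sub>F t in at_right 0. \<bar>remainder t \<omega>\<bar> \<le> \<rho> * lil_scale t"
proof -
  \<comment> \<open>Solves \<open>12 * sqrt (24 * \<epsilon> * exp 1) = \<rho>\<close>: 12 from
    chaining, 24 from the tail of the remainder, \<open>exp 1\<close> from the ratio of the
    grid.\<close>
  define \<epsilon> where "\<epsilon> = \<rho>\<^sup>2 / (144 * 24 * exp 1)"
  have "0 < \<epsilon>" using assms by (simp add: \<epsilon>_def)
  obtain \<delta> where \<delta>: "0 < \<delta>" "\<delta> \<le> 1"
    and incr: "\<And>u t. 0 \<le> u \<Longrightarrow> u < t \<Longrightarrow> t \<le> \<delta> \<Longrightarrow>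
      (\<integral>\<^sup>+s. ennreal ((kernel_deviation K t s - kernel_deviation K u s)\<^sup>2) \<partial>lborel) \<le> ennreal (\<epsilon> * (t - u))"
    by (rule kernel_deviation_increment[OF K_cont K_diff \<open>0 < \<epsilon>\<close>]) (rule that)
  define d where "d n = exp (- 1 * real n)" for n
  have d: "0 < d n" "d n \<le> 1" for n by (auto simp: d_def)
  have "d \<longlonglongrightarrow> 0" unfolding d_def by real_asymp
  from order_tendstoD(2)[OF this \<delta>(1)] obtain N where N: "\<And>n. N \<le> n \<Longrightarrow> d n < \<delta>"
    unfolding eventually_sequentially by blast
  have osc: "AE \<omega> in M. \<forall>\<^sub>F n in sequentially. \<forall>t\<in>{0..0 + d n}.
      \<bar>remainder t \<omega> - remainder 0 \<omega>\<bar> \<le> 12 * sqrt (2 * ln (real n)) * sqrt (24 * \<epsilon> * d n)"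
  proof (rule eventually_oscillation_le)
    show "0 < 24 * \<epsilon>" "\<And>n. 0 < d n" using \<open>0 < \<epsilon>\<close> d by auto
  next
    fix n t assume "t \<in> {0..0 + d n}"
    then show "remainder t \<in> borel_measurable M"
      using d(2)[of n] by (intro measurable_remainder) auto
  next
    fix n s t x assume *: "N \<le> n" "0 \<le> s" "s < t" "t \<le> 0 + d n" "(0::real) < x"
    then have "t < \<delta>" using N[of n] by simp
    have "prob {\<omega> \<in> space M. x \<le> \<bar>remainder t \<omega> - remainder s \<omega>\<bar>} \<le> 2 * exp (- x\<^sup>2 / (24 * (\<epsilon> * (t - s))))"
      using * \<open>t < \<delta>\<close> \<delta> \<open>0 < \<epsilon>\<close>
      by (intro wiener_approx_tail[OF W remainder_increment_approx] incr) auto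
    then show "prob {\<omega> \<in> space M. x \<le> \<bar>remainder t \<omega> - remainder s \<omega>\<bar>} \<le> 2 * exp (- x\<^sup>2 / (24 * \<epsilon> * (t - s)))"
      by (simp add: mult.assoc)
  next
    have "AE \<omega> in M. continuous_on {0..1} (\<lambda>t. W t \<omega>)" "AE \<omega> in M. continuous_on {0..1} (\<lambda>t. X t \<omega>)"
      using W X by (auto simp: wiener_process_def continuous_modification_def)
    then show "AE \<omega> in M. \<forall>n\<ge>N. continuous_on {0..0 + d n} (\<lambda>t. remainder t \<omega>)"
    proof eventually_elim
      case (elim \<omega>)
      then have "continuous_on {0..1} (\<lambda>t. remainder t \<omega>)"
        unfolding remainder_def by (intro continuous_intros)
      then show ?case
        using d(2) by (intro allI impI) (rule continuous_on_subset, auto intro: order_trans[OF _ d(2)])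
    qed
  qed
  from osc remainder_0 show ?thesis
  proof eventually_elim
    case (elim \<omega>)
    from elim(1) eventually_ge_at_top[of 1]
    have "\<forall>\<^sub>F n in sequentially. \<forall>t\<in>{d (Suc n)..d n}. \<bar>remainder t \<omega>\<bar> \<le> \<rho> * lil_scale t"
    proof eventually_elim
      case (elim n)
      show ?case
      proof
        fix t assume t: "t \<in> {d (Suc n)..d n}"
        then have "0 < t" using d(1)[of "Suc n"] by simp
        have "d n = exp 1 * d (Suc n)" by (simp add: d_def flip: exp_add)
        then have d_le: "d n \<le> exp 1 * t" using t by simp
        have "\<bar>remainder t \<omega>\<bar> \<le> 12 * sqrt (2 * ln (real n)) * sqrt (24 * \<epsilon> * d n)"
          using elim t \<open>0 < t\<close> \<open>remainder 0 \<omega> = 0\<close> by auto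
        also have "\<dots> \<le> 12 * sqrt (2 * ln (real n)) * sqrt (24 * \<epsilon> * (exp 1 * t))"
          using d_le \<open>0 < \<epsilon>\<close> elim by (intro mult_left_mono real_sqrt_le_mono) auto
        also have "\<dots> = 12 * sqrt (24 * \<epsilon> * exp 1) * sqrt (2 * t * ln (real n))"
          by (simp add: real_sqrt_mult)
        also have "12 * sqrt (24 * \<epsilon> * exp 1) = \<rho>"
        proof -
          have "24 * \<epsilon> * exp 1 = (\<rho> / 12)\<^sup>2" by (simp add: \<epsilon>_def power_divide)
          then show ?thesis using assms by simp
        qed
        also have "\<rho> * sqrt (2 * t * ln (real n)) \<le> \<rho> * lil_scale t"
          using lil_scale_ge_on_grid[of 1 t n] t \<open>0 < t\<close> elim assms by (simp add: d_def)
        finally show "\<bar>remainder t \<omega>\<bar> \<le> \<rho> * lil_scale t" .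
      qed
    qed
    then obtain N where N: "\<And>n t. N \<le> n \<Longrightarrow> t \<in> {d (Suc n)..d n} \<Longrightarrow> \<bar>remainder t \<omega>\<bar> \<le> \<rho> * lil_scale t"
      unfolding eventually_sequentially by blast
    have "\<forall>\<^sub>F t in at_right 0. t \<in> {0<..<d N}"
      using d(1)[of N] by (rule eventually_at_right_real)
    then show ?case
    proof eventually_elim
      case (elim t)
      then have "0 < t" "t \<le> exp (- 1 * real N)" by (auto simp: d_def)
      from geometric_grid_index[OF zero_less_one this] obtain n where
        "N \<le> n" "exp (- 1 * real (Suc n)) \<le> t" "t \<le> exp (- 1 * real n)" .
      then show ?case
        by (intro N[of n]) (auto simp only: d_def atLeastAtMost_iff)
    qed
  qed
qed

lemma variance_asymptotics:
  "((\<lambda>t. expectation (\<lambda>\<omega>. (X t \<omega>)\<^sup>2) / ((K 0 0)\<^sup>2 * t)) \<longlongrightarrow> 1) (at_right 0)"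
proof (rule tendstoI)
  fix e :: real assume "0 < e"
  define \<theta> where "\<theta> = min 1 (e / 3)"
  have \<theta>: "0 < \<theta>" "\<theta> \<le> 1" "2 * \<theta> < e" using \<open>0 < e\<close> by (auto simp: \<theta>_def min_def)
  define k where "k = (K 0 0)\<^sup>2"
  have "0 < k" using K_nz by (simp add: k_def)
  \<comment> \<open>Chosen so that the remainder, after Young's factor
    \<open>1 + 1 / \<theta>\<close>, contributes at most \<open>\<theta> * k * t\<close>.\<close>
  define \<epsilon> where "\<epsilon> = \<theta> * \<theta> * k / 16"
  have "0 < \<epsilon>" using \<theta> \<open>0 < k\<close> by (simp add: \<epsilon>_def)
  obtain \<delta> where \<delta>: "0 < \<delta>" "\<delta> \<le> 1"
    and incr: "\<And>u t. 0 \<le> u \<Longrightarrow> u < t \<Longrightarrow> t \<le> \<delta> \<Longrightarrow>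
      (\<integral>\<^sup>+s. ennreal ((kernel_deviation K t s - kernel_deviation K u s)\<^sup>2) \<partial>lborel) \<le> ennreal (\<epsilon> * (t - u))"
    by (rule kernel_deviation_increment[OF K_cont K_diff \<open>0 < \<epsilon>\<close>]) (rule that)
  have bound: "dist (expectation (\<lambda>\<omega>. (X t \<omega>)\<^sup>2) / (k * t)) 1 < e" if t: "t \<in> {0<..<\<delta>}" for t
  proof -
    have t01: "t \<in> {0..1}" "0 < t" using t \<delta> by auto
    note [measurable] = measurable_remainder[OF t01(1)] measurable_W[OF t01(1)] measurable_X[OF t01(1)]
    have [measurable]: "W 0 \<in> borel_measurable M" by (intro measurable_W) simp
    define B where "B \<omega> = K 0 0 * (W t \<omega> - W 0 \<omega>)" for \<omega>
    have [measurable]: "B \<in> borel_measurable M" unfolding B_def[abs_def] by measurable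
    have X_eq: "X t \<omega> = B \<omega> + remainder t \<omega>" for \<omega> by (simp add: B_def remainder_def)
    have "(\<integral>\<^sup>+\<omega>. ennreal ((W t \<omega> - W 0 \<omega>)\<^sup>2) \<partial>M) = ennreal t"
      using normal_second_moment[OF wiener_increment_normal[OF W, of 0 t]] t01 by simp
    then have B_nn: "(\<integral>\<^sup>+\<omega>. ennreal ((B \<omega>)\<^sup>2) \<partial>M) = ennreal (k * t)"
      unfolding B_def power_mult_distrib
      using t01 by (simp add: ennreal_mult nn_integral_cmult k_def)
    have B_int: "integrable M (\<lambda>\<omega>. (B \<omega>)\<^sup>2)"
      by (rule integrableI_nonneg) (auto simp: B_nn)
    have B_exp: "expectation (\<lambda>\<omega>. (B \<omega>)\<^sup>2) = k * t"
      using t01 \<open>0 < k\<close> by (subst integral_eq_nn_integral) (auto simp: B_nn)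
    have "(\<integral>\<^sup>+\<omega>. ennreal ((remainder t \<omega> - remainder 0 \<omega>)\<^sup>2) \<partial>M) \<le> ennreal (8 * (\<epsilon> * (t - 0)))"
      using t01 t \<open>0 < \<epsilon>\<close>
      by (intro wiener_approx_second_moment[OF W remainder_increment_approx] incr) auto
    also have "(\<integral>\<^sup>+\<omega>. ennreal ((remainder t \<omega> - remainder 0 \<omega>)\<^sup>2) \<partial>M) = (\<integral>\<^sup>+\<omega>. ennreal ((remainder t \<omega>)\<^sup>2) \<partial>M)"
      using remainder_0 by (intro nn_integral_cong_AE) (auto elim!: AE_mp)
    finally have R_nn: "(\<integral>\<^sup>+\<omega>. ennreal ((remainder t \<omega>)\<^sup>2) \<partial>M) \<le> ennreal (8 * \<epsilon> * t)" by (simp add: mult.assoc)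
    have R_int: "integrable M (\<lambda>\<omega>. (remainder t \<omega>)\<^sup>2)"
      by (rule integrableI_nonneg) (auto intro: le_less_trans[OF R_nn])
    have R_exp: "expectation (\<lambda>\<omega>. (remainder t \<omega>)\<^sup>2) \<le> 8 * \<epsilon> * t"
      using t01 \<open>0 < \<epsilon>\<close> R_nn by (subst integral_eq_nn_integral) (auto intro!: enn2real_leI)
    \<comment> \<open>Young's inequality, applied pointwise: only squares have to be integrated,
      never the product of the two parts.\<close>
    have cross: "\<bar>2 * (a * b)\<bar> \<le> \<theta> * a\<^sup>2 + b\<^sup>2 / \<theta>" for a b
    proof -
      have "(\<theta> * a + b)\<^sup>2 / \<theta> = \<theta> * a\<^sup>2 + b\<^sup>2 / \<theta> + 2 * (a * b)"
          "(\<theta> * a - b)\<^sup>2 / \<theta> = \<theta> * a\<^sup>2 + b\<^sup>2 / \<theta> - 2 * (a * b)"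
        using \<theta> by (simp_all add: power2_eq_square field_simps)
      moreover have "0 \<le> (\<theta> * a + b)\<^sup>2 / \<theta>" "0 \<le> (\<theta> * a - b)\<^sup>2 / \<theta>" using \<theta> by auto
      ultimately show ?thesis by linarith
    qed
    have upper: "(X t \<omega>)\<^sup>2 \<le> (1 + \<theta>) * (B \<omega>)\<^sup>2 + (1 + 1 / \<theta>) * (remainder t \<omega>)\<^sup>2"
      and lower: "(1 - \<theta>) * (B \<omega>)\<^sup>2 + (1 - 1 / \<theta>) * (remainder t \<omega>)\<^sup>2 \<le> (X t \<omega>)\<^sup>2" for \<omega>
      using cross[of "B \<omega>" "remainder t \<omega>"]
      by (simp_all add: X_eq power2_sum algebra_simps abs_le_iff)
    have X_int: "integrable M (\<lambda>\<omega>. (X t \<omega>)\<^sup>2)"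
      by (rule Bochner_Integration.integrable_bound[of M "\<lambda>\<omega>. (1 + \<theta>) * (B \<omega>)\<^sup>2 + (1 + 1 / \<theta>) * (remainder t \<omega>)\<^sup>2"])
         (use B_int R_int \<theta> upper in \<open>auto intro: order_trans[OF upper abs_ge_self]\<close>)
    have theta_k: "(1 + 1 / \<theta>) * (8 * \<epsilon> * t) \<le> \<theta> * (k * t)"
    proof -
      have "(1 + 1 / \<theta>) * (8 * \<epsilon> * t) = (\<theta> + 1) / 2 * (\<theta> * (k * t))"
        using \<theta> by (simp add: \<epsilon>_def field_simps)
      also have "\<dots> \<le> 1 * (\<theta> * (k * t))"
        using \<theta> t01 \<open>0 < k\<close> by (intro mult_right_mono) auto
      finally show ?thesis by simp
    qed
    have "expectation (\<lambda>\<omega>. (X t \<omega>)\<^sup>2)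
        \<le> expectation (\<lambda>\<omega>. (1 + \<theta>) * (B \<omega>)\<^sup>2 + (1 + 1 / \<theta>) * (remainder t \<omega>)\<^sup>2)"
      using X_int B_int R_int upper by (intro integral_mono) auto
    also have "\<dots> = (1 + \<theta>) * (k * t) + (1 + 1 / \<theta>) * expectation (\<lambda>\<omega>. (remainder t \<omega>)\<^sup>2)"
      using B_int R_int by (simp add: B_exp)
    also have "\<dots> \<le> (1 + \<theta>) * (k * t) + (1 + 1 / \<theta>) * (8 * \<epsilon> * t)"
      using R_exp \<theta> by (intro add_left_mono mult_left_mono) auto
    finally have 1: "expectation (\<lambda>\<omega>. (X t \<omega>)\<^sup>2) \<le> (1 + 2 * \<theta>) * (k * t)"
      using theta_k by (simp add: algebra_simps)
    \<comment> \<open>Lowering the coefficient \<open>1 - 1 / \<theta>\<close> to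
      \<open>- (1 + 1 / \<theta>)\<close> lets \<open>theta_k\<close> serve this direction as
      well.\<close>
    have "(1 - 2 * \<theta>) * (k * t) \<le> (1 - \<theta>) * (k * t) + - (1 + 1 / \<theta>) * (8 * \<epsilon> * t)"
      using theta_k by (simp add: algebra_simps)
    also have "\<dots> \<le> (1 - \<theta>) * (k * t) + - (1 + 1 / \<theta>) * expectation (\<lambda>\<omega>. (remainder t \<omega>)\<^sup>2)"
      using R_exp \<theta> by (intro add_left_mono mult_left_mono_neg) (auto intro: order_trans[of _ 0])
    also have "\<dots> \<le> (1 - \<theta>) * (k * t) + (1 - 1 / \<theta>) * expectation (\<lambda>\<omega>. (remainder t \<omega>)\<^sup>2)"
      by (intro add_left_mono mult_right_mono) auto
    also have "\<dots> = expectation (\<lambda>\<omega>. (1 - \<theta>) * (B \<omega>)\<^sup>2 + (1 - 1 / \<theta>) * (remainder t \<omega>)\<^sup>2)"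
      using B_int R_int by (simp add: B_exp)
    also have "\<dots> \<le> expectation (\<lambda>\<omega>. (X t \<omega>)\<^sup>2)"
      using X_int B_int R_int lower by (intro integral_mono) auto
    finally have 2: "(1 - 2 * \<theta>) * (k * t) \<le> expectation (\<lambda>\<omega>. (X t \<omega>)\<^sup>2)" .
    have "0 < k * t" using \<open>0 < k\<close> t01 by simp
    then have "expectation (\<lambda>\<omega>. (X t \<omega>)\<^sup>2) / (k * t) \<le> 1 + 2 * \<theta>"
        "1 - 2 * \<theta> \<le> expectation (\<lambda>\<omega>. (X t \<omega>)\<^sup>2) / (k * t)"
      using 1 2 by (simp_all only: pos_divide_le_eq pos_le_divide_eq)
    then show ?thesis using \<theta>(3) by (simp only: dist_real_def abs_less_iff) linarith
  qed
  have "\<forall>\<^sub>F t in at_right 0. t \<in> {0<..<\<delta>}"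
    using \<delta>(1) by (rule eventually_at_right_real)
  then show "\<forall>\<^sub>F t in at_right 0. dist (expectation (\<lambda>\<omega>. (X t \<omega>)\<^sup>2) / ((K 0 0)\<^sup>2 * t)) 1 < e"
    by eventually_elim (simp add: bound flip: k_def)
qed

text \<open>Writing \<open>K(0,0) W\<close> as the absolute value of \<open>K(0,0)\<close> times
  this process reduces the limsup to a positive factor.\<close>

lemma signed_wiener: "wiener_process M (\<lambda>t \<omega>. sgn (K 0 0) * W t \<omega>)"
  using W wiener_process_uminus[OF W] K_nz by (cases "0 < K 0 0") (auto simp: sgn_if)

theorem lil:
  "AE \<omega> in M. Limsup (at_right 0)
    (\<lambda>t. ereal (X t \<omega> / sqrt (2 * expectation (\<lambda>\<omega>'. (X t \<omega>')\<^sup>2) * ln (ln (1 / t))))) = 1"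
proof -
  define g where "g t = sqrt (expectation (\<lambda>\<omega>. (X t \<omega>)\<^sup>2) / ((K 0 0)\<^sup>2 * t))" for t
  define k where "k = \<bar>K 0 0\<bar>"
  have "0 < k" using K_nz by (simp add: k_def)
  have g: "(g \<longlongrightarrow> 1) (at_right 0)"
    unfolding g_def[abs_def] using tendsto_real_sqrt[OF variance_asymptotics] by simp
  have scale_pos: "\<forall>\<^sub>F t in at_right 0. 0 < lil_scale t"
    unfolding lil_scale_def by real_asymp
  \<comment> \<open>Countably many tolerances, so that the exceptional null sets can be
    united.\<close>
  define \<epsilon> where "\<epsilon> m = 1 / real (Suc m)" for m
  have \<epsilon>: "0 < \<epsilon> m" for m by (simp add: \<epsilon>_def)
  have \<epsilon>_small: "\<exists>m. 2 * \<epsilon> m < y" if "0 < y" for y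
    using reals_Archimedean[of "y / 2"] that by (auto simp: \<epsilon>_def field_simps)
  let ?V = "\<lambda>t \<omega>. sgn (K 0 0) * W t \<omega>"
  have "AE \<omega> in M. \<forall>m. \<forall>\<^sub>F t in at_right 0. ?V t \<omega> \<le> (1 + \<epsilon> m) * lil_scale t"
    using \<epsilon> wiener_upper[OF signed_wiener] by (intro AE_all_countable[THEN iffD2]) blast
  moreover have "AE \<omega> in M. \<forall>m. \<exists>\<^sub>F t in at_right 0. (1 - \<epsilon> m) * lil_scale t \<le> ?V t \<omega>"
    using \<epsilon> wiener_lower[OF signed_wiener] by (intro AE_all_countable[THEN iffD2]) blast
  moreover have "AE \<omega> in M. \<forall>m. \<forall>\<^sub>F t in at_right 0. \<bar>remainder t \<omega>\<bar> \<le> k * \<epsilon> m * lil_scale t"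
    using \<epsilon> \<open>0 < k\<close> remainder_negligible[of "k * \<epsilon> _"] by (intro AE_all_countable[THEN iffD2]) simp
  moreover have "AE \<omega> in M. W 0 \<omega> = 0"
    using W by (simp add: wiener_process_def)
  ultimately show ?thesis
  proof eventually_elim
    case (elim \<omega>)
    let ?f = "\<lambda>t. X t \<omega> / sqrt (2 * expectation (\<lambda>\<omega>'. (X t \<omega>')\<^sup>2) * ln (ln (1 / t)))"
    \<comment> \<open>An exact factorisation: the limsup of the signed Wiener process is perturbed
      additively by the remainder and multiplicatively by \<open>g\<close>.\<close>
    have quotient: "?f t = (?V t \<omega> + remainder t \<omega> / k) / lil_scale t / g t" if "0 < t" for t
    proof -
      define q where "q = expectation (\<lambda>\<omega>'. (X t \<omega>')\<^sup>2) / ((K 0 0)\<^sup>2 * t)"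
      have "expectation (\<lambda>\<omega>'. (X t \<omega>')\<^sup>2) = k\<^sup>2 * t * q"
        using that K_nz by (simp add: k_def q_def)
      then have "2 * expectation (\<lambda>\<omega>'. (X t \<omega>')\<^sup>2) * ln (ln (1 / t)) = k\<^sup>2 * ((2 * t * ln (ln (1 / t))) * q)"
        by simp
      then have "sqrt (2 * expectation (\<lambda>\<omega>'. (X t \<omega>')\<^sup>2) * ln (ln (1 / t))) = k * (lil_scale t * g t)"
        using \<open>0 < k\<close> by (simp only: real_sqrt_mult lil_scale_def g_def q_def real_sqrt_abs abs_of_pos)
      moreover have "X t \<omega> = k * (?V t \<omega> + remainder t \<omega> / k)"
        using K_nz elim(4) by (simp add: remainder_def k_def distrib_left abs_sgn mult_ac)
      ultimately show ?thesis using \<open>0 < k\<close> by simp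
    qed
    have g_pos: "\<forall>\<^sub>F t in at_right 0. 0 < g t"
      using order_tendstoD(1)[OF g, of 0] by simp
    have remainder: "\<forall>\<^sub>F t in at_right 0. \<bar>remainder t \<omega> / k\<bar> \<le> \<epsilon> m * lil_scale t" for m
      using elim(3)[rule_format, of m] by eventually_elim (use \<open>0 < k\<close> in \<open>simp add: field_simps\<close>)
    have t_pos: "\<forall>\<^sub>F t in at_right (0::real). 0 < t"
      by (rule eventually_at_right_less)
    show ?case
    proof (rule Limsup_ereal_eq_1)
      fix y :: real assume "1 < y"
      then obtain m where m: "2 * \<epsilon> m < y - 1" using \<epsilon>_small[of "y - 1"] by auto
      have "((\<lambda>t. (1 + 2 * \<epsilon> m) / g t) \<longlongrightarrow> (1 + 2 * \<epsilon> m) / 1) (at_right 0)"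
        by (intro tendsto_intros g) simp
      from order_tendstoD(2)[OF this, of y] m have "\<forall>\<^sub>F t in at_right 0. (1 + 2 * \<epsilon> m) / g t < y"
        by simp
      then show "\<forall>\<^sub>F t in at_right 0. ?f t \<le> y"
        using elim(1)[rule_format, of m] remainder[of m] g_pos scale_pos t_pos
      proof eventually_elim
        case (elim t)
        have "(1 + 2 * \<epsilon> m) * lil_scale t = (1 + \<epsilon> m) * lil_scale t + \<epsilon> m * lil_scale t"
          by (simp add: algebra_simps)
        with elim(2) abs_le_D1[OF elim(3)]
        have "?V t \<omega> + remainder t \<omega> / k \<le> (1 + 2 * \<epsilon> m) * lil_scale t" by linarith
        then have "(?V t \<omega> + remainder t \<omega> / k) / lil_scale t \<le> 1 + 2 * \<epsilon> m"
          by (simp only: pos_divide_le_eq[OF elim(5)])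
        then have "?f t \<le> (1 + 2 * \<epsilon> m) / g t"
          unfolding quotient[OF \<open>0 < t\<close>] using elim by (intro divide_right_mono) auto
        then show ?case using elim by linarith
      qed
    next
      fix y :: real assume "y < 1"
      then obtain m where m: "2 * \<epsilon> m < 1 - y" using \<epsilon>_small[of "1 - y"] by auto
      have "((\<lambda>t. (1 - 2 * \<epsilon> m) / g t) \<longlongrightarrow> (1 - 2 * \<epsilon> m) / 1) (at_right 0)"
        by (intro tendsto_intros g) simp
      from order_tendstoD(1)[OF this, of y] m have "\<forall>\<^sub>F t in at_right 0. y < (1 - 2 * \<epsilon> m) / g t"
        by simp
      then have "\<forall>\<^sub>F t in at_right 0. (1 - \<epsilon> m) * lil_scale t \<le> ?V t \<omega> \<longrightarrow> y \<le> ?f t"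
        using remainder[of m] g_pos scale_pos t_pos
      proof eventually_elim
        case (elim t)
        show ?case
        proof
          assume "(1 - \<epsilon> m) * lil_scale t \<le> ?V t \<omega>"
          moreover have "(1 - 2 * \<epsilon> m) * lil_scale t = (1 - \<epsilon> m) * lil_scale t - \<epsilon> m * lil_scale t"
            by (simp add: algebra_simps)
          ultimately have "(1 - 2 * \<epsilon> m) * lil_scale t \<le> ?V t \<omega> + remainder t \<omega> / k"
            using abs_le_D2[OF elim(2)] by linarith
          then have "1 - 2 * \<epsilon> m \<le> (?V t \<omega> + remainder t \<omega> / k) / lil_scale t"
            by (simp only: pos_le_divide_eq[OF elim(4)])
          then have "(1 - 2 * \<epsilon> m) / g t \<le> ?f t"
            unfolding quotient[OF \<open>0 < t\<close>] using elim by (intro divide_right_mono) auto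
          then show "y \<le> ?f t" using elim by linarith
        qed
      qed
      with elim(2)[rule_format, of m] show "\<exists>\<^sub>F t in at_right 0. y \<le> ?f t"
        by (rule frequently_rev_mp)
    qed
  qed
qed

end

theorem theorem3p1:
  fixes M :: "'a measure"
    and W X Y :: "real \<Rightarrow> 'a \<Rightarrow> real"
    and K :: "real \<Rightarrow> real \<Rightarrow> real"
  assumes "continuous_on ({0..1} \<times> {0..1}) (\<lambda>(t, s). K t s)"
    and "continuously_differentiable_fst K"
    and "K 0 0 \<noteq> 0"
    and "wiener_process M W"
    and "volterra_process M W K Y"
    and "continuous_modification M {0..1} Y X"
  shows "AE \<omega> in M. Limsup (at_right 0)
           (\<lambda>t. ereal (X t \<omega> / sqrt (2 * prob_space.expectation M (\<lambda>\<omega>'. (X t \<omega>')\<^sup>2) * ln (ln (1 / t))))) = 1"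
proof -
  interpret volterra M W X Y K using assms by (rule volterra.intro)
  show ?thesis by (rule lil)
qed

end
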